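(* Let $\mathscr{P}$ be the Lindelöf property and let $X$ be a paracompact locally-$\mathscr{P}$ space. Then $C_{\mathscr{P}}(X)$ is a Banach subalgebra of $C_b(X)$ isometrically isomorphic to $C_c(Y)$ for some locally compact space $Y$, unique up to homeomorphism, namely $Y=\lambda_{\mathscr{P}}X$. Moreover: (1) $C_{\mathscr{P}}(X)=\{f\in C_b(X):\mathrm{supp}(f)\text{ is Lindelöf}\}$. (2) $C_0(X)\subseteq C_{\mathscr{P}}(X)$, and the inclusion is proper if $X$ is not Lindelöf. (3) $C_c(Y)=C_0(Y)$. (4) $Y$ is countably compact. (5) $Y$ is neither Lindelöf nor paracompact, if $X$ is not Lindelöf. If $X$ is moreover locally compact, then in addition: (6) $C_{\mathscr{P}}(X)=\{f\in C_b(X):\mathrm{supp}(f)\text{ is }\sigma\text{-compact}\}$. (7) $Y$ is non-normal, if $X$ is not Lindelöf.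
   Context: The scalar field is fixed and is either $\mathbb{R}$ or $\mathbb{C}$. Spaces are topological spaces, assumed non-empty. Normal and completely regular spaces are Hausdorff; compact, locally compact and paracompact spaces are Hausdorff; Lindelöf spaces are regular (Hausdorff). A $\mathscr{P}$-neighborhood of a point (or set) is a neighborhood of it (i.e. a set whose interior contains it) that, as a subspace, has $\mathscr{P}$. $X$ is locally-$\mathscr{P}$ if each of its points has a $\mathscr{P}$-neighborhood in $X$. $C_b(X)$ is the algebra of continuous bounded scalar-valued functions on $X$ with the supremum norm. For $f\in C_b(X)$, $\mathrm{Coz}(f)=\{x\in X: f(x)\neq 0\}$, $\mathrm{supp}(f)=\mathrm{cl}_X\mathrm{Coz}(f)$, and $\mathrm{Coz}(X)=\{\mathrm{Coz}(f):f\in C_b(X)\}$. $C_c(X)$ is the set of $f\in C_b(X)$ with compact support, and $C_0(X)$ is the set of $f\in C_b(X)$ such that $|f|^{-1}([\epsilon,\infty))$ is compact for each $\epsilon>0$ (similarly for $Y$). Define $$C_{\mathscr{P}}(X)=\{f\in C_b(X):\mathrm{supp}(f)\text{ has a }\mathscr{P}\text{-neighborhood in }X\}.$$ For a completely regular space $X$ with Stone–Čech compactification $\beta X$, define the subspace $$\lambda_{\mathscr{P}}X=\bigcup\{\mathrm{int}_{\beta X}\mathrm{cl}_{\beta X}C: C\in\mathrm{Coz}(X)\text{ and }\mathrm{cl}_XC\text{ has }\mathscr{P}\}$$ of $\beta X$. *)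

theory Defs
  imports "HOL-Analysis.Analysis"
begin

text \<open>Spaces are abstract topologies. The scalar field is a type of sort
  \<open>{real_normed_field, euclidean_space}\<close>: a finite-dimensional commutative real division algebra
  with multiplicative norm, hence (isometrically) the reals or the complex numbers. Both
  \<^typ>\<open>real\<close> and \<^typ>\<open>complex\<close> are instances.\<close>

section \<open>Topological properties\<close>

definition lindelof :: "'a topology \<Rightarrow> bool" where
  "lindelof X \<longleftrightarrow> Lindelof_space X \<and> regular_space X \<and> Hausdorff_space X"

definition paracompact :: "'a topology \<Rightarrow> bool" where
  "paracompact X \<longleftrightarrow> Hausdorff_space X \<and>
     (\<forall>\<U>. (\<forall>U\<in>\<U>. openin X U) \<and> \<Union>\<U> = topspace X \<longrightarrow>
       (\<exists>\<V>. (\<forall>V\<in>\<V>. openin X V) \<and> \<Union>\<V> = topspace X \<and>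
            (\<forall>V\<in>\<V>. \<exists>U\<in>\<U>. V \<subseteq> U) \<and> locally_finite_in X \<V>))"

definition locally_compact :: "'a topology \<Rightarrow> bool" where
  "locally_compact X \<longleftrightarrow> locally_compact_space X \<and> Hausdorff_space X"

definition normal_T2_space :: "'a topology \<Rightarrow> bool" where
  "normal_T2_space X \<longleftrightarrow> normal_space X \<and> Hausdorff_space X"

definition countably_compact_space :: "'a topology \<Rightarrow> bool" where
  "countably_compact_space X \<longleftrightarrow>
     (\<forall>\<U>. countable \<U> \<and> (\<forall>U\<in>\<U>. openin X U) \<and> \<Union>\<U> = topspace X \<longrightarrow>
       (\<exists>\<V>. finite \<V> \<and> \<V> \<subseteq> \<U> \<and> \<Union>\<V> = topspace X))"

definition sigma_compact :: "'a topology \<Rightarrow> bool" where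
  "sigma_compact X \<longleftrightarrow>
     (\<exists>\<K>. countable \<K> \<and> (\<forall>K\<in>\<K>. compactin X K) \<and> \<Union>\<K> = topspace X)"

definition has_P_neighbourhood ::
    "('a topology \<Rightarrow> bool) \<Rightarrow> 'a topology \<Rightarrow> 'a set \<Rightarrow> bool" where
  "has_P_neighbourhood P X S \<longleftrightarrow>
     (\<exists>N \<subseteq> topspace X. S \<subseteq> X interior_of N \<and> P (subtopology X N))"

definition locally_P :: "('a topology \<Rightarrow> bool) \<Rightarrow> 'a topology \<Rightarrow> bool" where
  "locally_P P X \<longleftrightarrow> (\<forall>x\<in>topspace X. has_P_neighbourhood P X {x})"

section \<open>Algebras of bounded continuous functions\<close>

text \<open>A function on the space \<open>X\<close> is represented by the HOL function that vanishes outside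
  \<^term>\<open>topspace X\<close>, so that equality of representatives is equality on \<open>X\<close> and the
  algebra operations are the pointwise ones.\<close>

definition C_b :: "'a topology \<Rightarrow> ('a \<Rightarrow> 'k::real_normed_field) set" where
  "C_b X = {f. continuous_map X euclidean f \<and> bounded (f ` topspace X) \<and>
               (\<forall>x. x \<notin> topspace X \<longrightarrow> f x = 0)}"

definition supnorm :: "'a topology \<Rightarrow> ('a \<Rightarrow> 'k::real_normed_field) \<Rightarrow> real" where
  "supnorm X f = (SUP x\<in>topspace X. norm (f x))"

definition Coz :: "'a topology \<Rightarrow> ('a \<Rightarrow> 'k::real_normed_field) \<Rightarrow> 'a set" where
  "Coz X f = {x \<in> topspace X. f x \<noteq> 0}"

definition supp :: "'a topology \<Rightarrow> ('a \<Rightarrow> 'k::real_normed_field) \<Rightarrow> 'a set" where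
  "supp X f = X closure_of (Coz X f)"

definition cozero_sets :: "'k::real_normed_field itself \<Rightarrow> 'a topology \<Rightarrow> 'a set set" where
  "cozero_sets _ X = Coz X ` (C_b X :: ('a \<Rightarrow> 'k) set)"

definition C_c :: "'a topology \<Rightarrow> ('a \<Rightarrow> 'k::real_normed_field) set" where
  "C_c X = {f \<in> C_b X. compactin X (supp X f)}"

definition C_0 :: "'a topology \<Rightarrow> ('a \<Rightarrow> 'k::real_normed_field) set" where
  "C_0 X = {f \<in> C_b X. \<forall>\<epsilon>>0. compactin X {x \<in> topspace X. norm (f x) \<ge> \<epsilon>}}"

definition C_P ::
    "('a topology \<Rightarrow> bool) \<Rightarrow> 'a topology \<Rightarrow> ('a \<Rightarrow> 'k::real_normed_field) set" where
  "C_P P X = {f \<in> C_b X. has_P_neighbourhood P X (supp X f)}"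

text \<open>Not required to contain the constant function one.\<close>

definition subalgebra_C_b :: "'a topology \<Rightarrow> ('a \<Rightarrow> 'k::real_normed_field) set \<Rightarrow> bool" where
  "subalgebra_C_b X A \<longleftrightarrow> A \<subseteq> C_b X \<and> (\<lambda>x. 0) \<in> A \<and>
     (\<forall>f\<in>A. \<forall>g\<in>A. (\<lambda>x. f x + g x) \<in> A) \<and>
     (\<forall>c. \<forall>f\<in>A. (\<lambda>x. c * f x) \<in> A) \<and>
     (\<forall>f\<in>A. \<forall>g\<in>A. (\<lambda>x. f x * g x) \<in> A)"

definition supnorm_complete :: "'a topology \<Rightarrow> ('a \<Rightarrow> 'k::real_normed_field) set \<Rightarrow> bool" where
  "supnorm_complete X A \<longleftrightarrow>
     (\<forall>s :: nat \<Rightarrow> 'a \<Rightarrow> 'k. (\<forall>n. s n \<in> A) \<and>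
         (\<forall>e>0. \<exists>N. \<forall>m\<ge>N. \<forall>n\<ge>N. supnorm X (\<lambda>x. s m x - s n x) < e) \<longrightarrow>
       (\<exists>f\<in>A. (\<lambda>n. supnorm X (\<lambda>x. s n x - f x)) \<longlonglongrightarrow> 0))"

definition banach_subalgebra_C_b ::
    "'a topology \<Rightarrow> ('a \<Rightarrow> 'k::real_normed_field) set \<Rightarrow> bool" where
  "banach_subalgebra_C_b X A \<longleftrightarrow> subalgebra_C_b X A \<and> supnorm_complete X A"

text \<open>Isometric isomorphism of (normed) algebras over the scalar field.\<close>

definition isometrically_isomorphic ::
    "'a topology \<Rightarrow> ('a \<Rightarrow> 'k::real_normed_field) set \<Rightarrow>
     'b topology \<Rightarrow> ('b \<Rightarrow> 'k) set \<Rightarrow> bool" where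
  "isometrically_isomorphic X A Y B \<longleftrightarrow>
     (\<exists>\<phi>. bij_betw \<phi> A B \<and>
       (\<forall>f\<in>A. \<forall>g\<in>A. \<phi> (\<lambda>x. f x + g x) = (\<lambda>y. \<phi> f y + \<phi> g y)) \<and>
       (\<forall>c. \<forall>f\<in>A. \<phi> (\<lambda>x. c * f x) = (\<lambda>y. c * \<phi> f y)) \<and>
       (\<forall>f\<in>A. \<forall>g\<in>A. \<phi> (\<lambda>x. f x * g x) = (\<lambda>y. \<phi> f y * \<phi> g y)) \<and>
       (\<forall>f\<in>A. supnorm Y (\<phi> f) = supnorm X f))"

section \<open>The Stone--Cech compactification and its subspace \<open>\<lambda>\<^sub>P X\<close>\<close>

text \<open>The Stone--Cech compactification is the closure of the image of \<open>X\<close> under the evaluation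
  map into the cube indexed by all continuous maps from \<open>X\<close> to the unit interval. For completely
  regular Hausdorff \<open>X\<close> the map \<open>beta_embed X\<close> is an embedding, along which \<open>X\<close> is regarded as
  a subspace of \<open>beta X\<close>.\<close>

definition unit_funs :: "'a topology \<Rightarrow> ('a \<Rightarrow> real) set" where
  "unit_funs X = {f \<in> C_b X. f ` topspace X \<subseteq> {0..1}}"

definition unit_cube :: "'a topology \<Rightarrow> (('a \<Rightarrow> real) \<Rightarrow> real) topology" where
  "unit_cube X = product_topology (\<lambda>_. top_of_set {0..1}) (unit_funs X)"

definition beta_embed :: "'a topology \<Rightarrow> 'a \<Rightarrow> ('a \<Rightarrow> real) \<Rightarrow> real" where
  "beta_embed X x = (\<lambda>f\<in>unit_funs X. f x)"

definition beta :: "'a topology \<Rightarrow> (('a \<Rightarrow> real) \<Rightarrow> real) topology" where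
  "beta X = subtopology (unit_cube X) (unit_cube X closure_of (beta_embed X ` topspace X))"

text \<open>The type argument is the scalar field over which cozero-sets are taken.\<close>

definition lambda_P ::
    "'k::real_normed_field itself \<Rightarrow> ('a topology \<Rightarrow> bool) \<Rightarrow> 'a topology \<Rightarrow>
     (('a \<Rightarrow> real) \<Rightarrow> real) topology" where
  "lambda_P k P X = subtopology (beta X)
     (\<Union>{beta X interior_of (beta X closure_of (beta_embed X ` C)) | C.
          C \<in> cozero_sets k X \<and> P (subtopology X (X closure_of C))})"

end

theory Submission
  imports Defs
begin

text \<open>A paracompact locally Lindelof space \<open>X\<close> is the disjoint union of clopen Lindelof pieces, so the
  functions with Lindelof support are those vanishing off a union of countably many pieces. Such a
  union \<open>S\<close> is clopen, and its closure in \<open>beta X\<close> is clopen and compact; the space \<open>Y\<close> is the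
  union of these closures. Countable families of such \<open>S\<close> have upper bounds of the same kind, so
  every \<open>\<sigma>\<close>-compact subset of \<open>Y\<close> lies in one compact clopen set, which gives countable compactness
  and \<open>C_c Y = C_0 Y\<close>; completeness of \<open>C_P X\<close> has the same reason. Extension to \<open>beta X\<close>
  identifies \<open>C_P X\<close> with \<open>C_c Y\<close>, and \<open>Y\<close> is recovered from the algebra \<open>C_c Y\<close> as its space of
  characters. If \<open>X\<close> is not Lindelof there are uncountably many pieces, and \<open>Y\<close> fails to be normal,
  hence is neither Lindelof nor paracompact.\<close>

section \<open>Paracompact locally Lindelof spaces\<close>

text \<open>Pieces make the problem zero-dimensional: a union of pieces is clopen, a single
  coordinate of the cube cuts out its closure in \<open>beta X\<close>, and passing to closures
  respects intersections and complements of such unions. Non-normality is the part with a real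
  obstacle. A closed subset of \<open>Y\<close> lying over countably many pieces is compact and can
  be separated from any disjoint closed set, so both of two inseparable closed sets must run through
  uncountably many pieces; moreover they are disjoint in \<open>Y\<close> although their closures in
  \<open>beta X\<close> must meet. Finite sets \<open>a\<close> of labels taken from an uncountable
  \<open>I\<close> give the disjointness, because countably many finite sets never cover
  \<open>I\<close>. The second index \<open>w\<close>, a natural number, gives room at each
  \<open>a\<close> for independent conditions. Independent families on the naturals have at most
  continuum many members, so the labels are required to inject into \<open>nat set\<close>.\<close>

lemma paracompact_refinement:
  assumes "paracompact X" "\<Union>\<U> = topspace X" "\<And>U. U \<in> \<U> \<Longrightarrow> openin X U"
  obtains \<V> where "\<forall>V\<in>\<V>. openin X V" "\<Union>\<V> = topspace X"
    "\<forall>V\<in>\<V>. \<exists>U\<in>\<U>. V \<subseteq> U" "locally_finite_in X \<V>"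
proof -
  have "(\<forall>U\<in>\<U>. openin X U) \<and> \<Union>\<U> = topspace X" using assms by simp
  from assms(1)[unfolded paracompact_def, THEN conjunct2, THEN spec, THEN mp, OF this] that
  show thesis by (elim exE conjE)
qed

text \<open>Members of a locally finite refinement that meet \<open>B\<close> have closures missing
  \<open>A\<close>, and local finiteness makes the closure of their union the union of their
  closures, so it misses \<open>A\<close> too. Used twice: with \<open>A\<close> a point it lifts
  Hausdorff to regular, and then with \<open>A\<close> closed it lifts regular to normal.\<close>

lemma paracompact_separation:
  assumes X: "paracompact X" and A: "closedin X A" and B: "closedin X B"
    and sep: "\<And>b. b \<in> B \<Longrightarrow> \<exists>U V. openin X U \<and> openin X V \<and> b \<in> U \<and> A \<subseteq> V \<and> disjnt U V"
  shows "\<exists>U V. openin X U \<and> openin X V \<and> B \<subseteq> U \<and> A \<subseteq> V \<and> disjnt U V"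
proof -
  define \<U> where "\<U> = insert (topspace X - B) {U. openin X U \<and> disjnt A (X closure_of U)}"
  have "\<exists>U\<in>\<U>. b \<in> U" if b: "b \<in> B" for b
  proof -
    obtain U V where UV: "openin X U" "openin X V" "b \<in> U" "A \<subseteq> V" "disjnt U V"
      using sep[OF b] by blast
    have "V \<inter> X closure_of U = {}"
      using UV by (simp add: openin_Int_closure_of_eq_empty disjnt_def Int_commute)
    then have "disjnt A (X closure_of U)"
      using UV by (auto simp: disjnt_def)
    then show ?thesis using UV by (auto simp: \<U>_def)
  qed
  then have "\<Union>\<U> = topspace X"
    by (auto simp: \<U>_def dest: openin_subset)
  moreover have "\<And>U. U \<in> \<U> \<Longrightarrow> openin X U"
    using B by (auto simp: \<U>_def)
  ultimately obtain \<V> where \<V>: "\<forall>V\<in>\<V>. openin X V" "\<Union>\<V> = topspace X"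
      "\<forall>V\<in>\<V>. \<exists>U\<in>\<U>. V \<subseteq> U" "locally_finite_in X \<V>"
    by (rule paracompact_refinement[OF X])
  define \<W> where "\<W> = {V \<in> \<V>. V \<inter> B \<noteq> {}}"
  have lf: "locally_finite_in X \<W>"
    by (rule locally_finite_in_subset[OF \<V>(4)]) (auto simp: \<W>_def)
  have "disjnt A (X closure_of W)" if W: "W \<in> \<W>" for W
  proof -
    obtain U where U: "U \<in> \<U>" "W \<subseteq> U" using \<V>(3) W by (auto simp: \<W>_def)
    then have "disjnt A (X closure_of U)" using that by (auto simp: \<U>_def \<W>_def)
    then show ?thesis using closure_of_mono[OF U(2), of X] by (auto simp: disjnt_def)
  qed
  then have "disjnt A (X closure_of (\<Union>\<W>))"
    by (auto simp: closure_of_locally_finite_Union[OF lf] disjnt_def)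
  moreover have "A \<subseteq> topspace X" "B \<subseteq> topspace X" using A B closedin_subset by auto
  moreover have "\<Union>\<W> \<subseteq> X closure_of (\<Union>\<W>)"
    using \<V>(1) by (intro closure_of_subset) (auto simp: \<W>_def dest: openin_subset)
  moreover have "B \<subseteq> \<Union>\<W>"
    using \<open>B \<subseteq> topspace X\<close> \<V>(2) unfolding \<W>_def by blast
  moreover have "openin X (\<Union>\<W>)" using \<V>(1) by (auto simp: \<W>_def)
  ultimately show ?thesis
    by (intro exI[of _ "\<Union>\<W>"] exI[of _ "topspace X - X closure_of (\<Union>\<W>)"])
       (auto simp: disjnt_def)
qed

lemma paracompact_imp_regular_space:
  assumes "paracompact X"
  shows "regular_space X"
  unfolding regular_space_def
proof clarify
  fix C a assume C: "closedin X C" and a: "a \<in> topspace X" "a \<notin> C"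
  have H: "Hausdorff_space X" using assms by (simp add: paracompact_def)
  then have "closedin X {a}" using a by (simp add: closedin_Hausdorff_singleton)
  moreover have "\<exists>U V. openin X U \<and> openin X V \<and> c \<in> U \<and> {a} \<subseteq> V \<and> disjnt U V" if "c \<in> C" for c
  proof -
    have "c \<in> topspace X" "c \<noteq> a" using that a closedin_subset[OF C] by auto
    then show ?thesis using H a by (simp add: Hausdorff_space_def)
  qed
  ultimately obtain U V where "openin X U" "openin X V" "C \<subseteq> U" "{a} \<subseteq> V" "disjnt U V"
    using paracompact_separation[OF assms _ C, of "{a}"] by blast
  then show "\<exists>U V. openin X U \<and> openin X V \<and> a \<in> U \<and> C \<subseteq> V \<and> disjnt U V"
    by (intro exI[of _ V] exI[of _ U]) (auto simp: disjnt_def)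
qed

lemma paracompact_imp_normal_space:
  assumes "paracompact X"
  shows "normal_space X"
  unfolding normal_space_def
proof clarify
  fix S T assume S: "closedin X S" and T: "closedin X T" and ST: "disjnt S T"
  have "\<exists>U V. openin X U \<and> openin X V \<and> b \<in> U \<and> T \<subseteq> V \<and> disjnt U V" if "b \<in> S" for b
    using paracompact_imp_regular_space[OF assms] T that ST closedin_subset[OF S]
    unfolding regular_space_def disjnt_def by blast
  from paracompact_separation[OF assms T S this]
  show "\<exists>U V. openin X U \<and> openin X V \<and> S \<subseteq> U \<and> T \<subseteq> V \<and> disjnt U V" by blast
qed

text \<open>These sets are the common currency of the proof: Lindelof supports, Lindelof
  neighbourhoods of supports, cozero-sets with Lindelof closure and compact subsets of
  \<open>Y\<close> are all bounded by one of them.\<close>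

definition clopen_Lindelof :: "'a topology \<Rightarrow> 'a set \<Rightarrow> bool" where
  "clopen_Lindelof X S \<longleftrightarrow> openin X S \<and> closedin X S \<and> Lindelof_space (subtopology X S)"

text \<open>The classes of a locally finite cover under the chain relation are unions of countably many
  members, since a Lindelof set meets only countably many members.\<close>

lemma paracompact_locally_Lindelof_partition:
  assumes X: "paracompact X" and loc: "locally_P lindelof X"
  obtains \<B> where "\<Union>\<B> = topspace X" "disjoint \<B>" "{} \<notin> \<B>"
    "\<And>B. B \<in> \<B> \<Longrightarrow> openin X B" "\<And>B. B \<in> \<B> \<Longrightarrow> Lindelof_space (subtopology X B)"
proof -
  \<comment> \<open>The closure, not \<open>U\<close> itself, is required to be Lindelof: the
    property passes to closed subspaces, hence to the closures of the members of any refinement,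
    while open subsets of a Lindelof set may lose it.\<close>
  define \<U> where "\<U> = {U. openin X U \<and> Lindelof_space (subtopology X (X closure_of U))}"
  have "\<exists>U\<in>\<U>. x \<in> U" if x: "x \<in> topspace X" for x
  proof -
    obtain N where N: "N \<subseteq> topspace X" "x \<in> X interior_of N" "lindelof (subtopology X N)"
      using loc x unfolding locally_P_def has_P_neighbourhood_def by auto
    have "closedin X (topspace X - X interior_of N)" by auto
    then obtain U where U: "openin X U" "x \<in> U" "disjnt (topspace X - X interior_of N) (X closure_of U)"
      using paracompact_imp_regular_space[OF X] N(2) x unfolding regular_space by blast
    have sub: "X closure_of U \<subseteq> N"
      using U(3) interior_of_subset[of X N] closure_of_subset_topspace[of X U] by (auto simp: disjnt_def)
    then have "closedin (subtopology X N) (X closure_of U)"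
      by (simp add: closedin_subset_topspace)
    then have "Lindelof_space (subtopology (subtopology X N) (X closure_of U))"
      using N(3) Lindelof_space_closedin_subtopology by (auto simp: lindelof_def)
    then have "Lindelof_space (subtopology X (X closure_of U))"
      using sub by (simp add: subtopology_subtopology Int_absorb1)
    then show ?thesis using U by (auto simp: \<U>_def)
  qed
  then have "\<Union>\<U> = topspace X"
    by (auto simp: \<U>_def dest: openin_subset)
  moreover have "\<And>U. U \<in> \<U> \<Longrightarrow> openin X U" by (auto simp: \<U>_def)
  ultimately obtain \<V>' where \<V>': "\<forall>V\<in>\<V>'. openin X V" "\<Union>\<V>' = topspace X"
      "\<forall>V\<in>\<V>'. \<exists>U\<in>\<U>. V \<subseteq> U" "locally_finite_in X \<V>'"
    by (rule paracompact_refinement[OF X])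
  define \<V> where "\<V> = \<V>' - {{}}"
  have \<V>: "\<And>V. V \<in> \<V> \<Longrightarrow> openin X V" "\<Union>\<V> = topspace X" "locally_finite_in X \<V>"
    using \<V>' locally_finite_in_subset[OF \<V>'(4), of \<V>] by (auto simp: \<V>_def)
  have LV: "Lindelof_space (subtopology X (X closure_of V))" if V: "V \<in> \<V>" for V
  proof -
    obtain U where U: "U \<in> \<U>" "V \<subseteq> U" using \<V>'(3) V by (auto simp: \<V>_def)
    have sub: "X closure_of V \<subseteq> X closure_of U" by (rule closure_of_mono[OF U(2)])
    then have "closedin (subtopology X (X closure_of U)) (X closure_of V)"
      by (simp add: closedin_subset_topspace)
    then have "Lindelof_space (subtopology (subtopology X (X closure_of U)) (X closure_of V))"
      using U Lindelof_space_closedin_subtopology by (auto simp: \<U>_def)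
    then show ?thesis using sub by (simp add: subtopology_subtopology Int_absorb1)
  qed
  define r where "r = {(V,W). V \<in> \<V> \<and> W \<in> \<V> \<and> V \<inter> W \<noteq> {}}"
  have r1: "countable (r `` {V})" for V
  proof (cases "V \<in> \<V>")
    case True
    \<comment> \<open>The closure of \<open>V\<close> is covered by open sets meeting only finitely
      many members; countably many of these suffice, so \<open>V\<close> meets only countably many
      members.\<close>
    define \<G> where "\<G> = {G. openin X G \<and> finite {W\<in>\<V>. W \<inter> G \<noteq> {}}}"
    have "X closure_of V \<subseteq> \<Union>\<G>"
      using \<V>(3) closure_of_subset_topspace[of X V] unfolding locally_finite_in_def \<G>_def by blast
    then obtain \<C> where \<C>: "countable \<C>" "\<C> \<subseteq> \<G>" "X closure_of V \<subseteq> \<Union>\<C>"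
      using LV[OF True] unfolding Lindelof_space_subtopology_subset[OF closure_of_subset_topspace]
      by (metis (no_types, lifting) \<G>_def mem_Collect_eq)
    have "V \<subseteq> X closure_of V" using \<V>(1)[OF True] by (simp add: closure_of_subset openin_subset)
    then have "r `` {V} \<subseteq> (\<Union>G\<in>\<C>. {W\<in>\<V>. W \<inter> G \<noteq> {}})"
      using \<C>(3) by (fastforce simp: r_def)
    moreover have "countable (\<Union>G\<in>\<C>. {W\<in>\<V>. W \<inter> G \<noteq> {}})"
      using \<C> by (intro countable_UN) (auto simp: \<G>_def intro: countable_finite)
    ultimately show ?thesis using countable_subset by blast
  next
    case False
    then have "r `` {V} = {}" by (auto simp: r_def)
    then show ?thesis by simp
  qed
  have rn: "countable ((r ^^ n) `` {V})" for n V
  proof (induction n)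
    case (Suc n)
    have "(r ^^ Suc n) `` {V} = (\<Union>W\<in>(r ^^ n) `` {V}. r `` {W})" by auto
    then show ?case using Suc r1 by simp
  qed simp
  have rs: "countable (r\<^sup>* `` {V})" for V
  proof -
    have "r\<^sup>* `` {V} = (\<Union>n. (r ^^ n) `` {V})" by (auto simp: rtrancl_power)
    then show ?thesis using rn by simp
  qed
  have sym: "sym (r\<^sup>*)" by (rule sym_rtrancl) (auto simp: sym_def r_def)
  have rV: "W \<in> \<V>" if "(V, W) \<in> r\<^sup>*" "V \<in> \<V>" for V W
    using that by (induction rule: rtrancl_induct) (auto simp: r_def)
  define blk where "blk V = \<Union>(r\<^sup>* `` {V})" for V
  have blk_eq: "blk V = blk W" if V: "V \<in> \<V>" and W: "W \<in> \<V>" and VW: "blk V \<inter> blk W \<noteq> {}" for V W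
  proof -
    obtain x where "x \<in> blk V" "x \<in> blk W" using VW by blast
    then obtain A B where *: "(V, A) \<in> r\<^sup>*" "(W, B) \<in> r\<^sup>*" "x \<in> A" "x \<in> B"
      unfolding blk_def by blast
    have "(A, B) \<in> r"
      using rV[OF *(1) V] rV[OF *(2) W] *(3,4) by (auto simp: r_def)
    then have "(V, B) \<in> r\<^sup>*" using *(1) by (rule rtrancl_into_rtrancl[rotated])
    then have "(V, W) \<in> r\<^sup>*" using symD[OF sym *(2)] by (rule rtrancl_trans)
    then have "(W, V) \<in> r\<^sup>*" using sym by (rule symD[rotated])
    then have "r\<^sup>* `` {V} = r\<^sup>* `` {W}"
      using \<open>(V, W) \<in> r\<^sup>*\<close> by (auto intro: rtrancl_trans)
    then show ?thesis by (simp add: blk_def)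
  qed
  define \<B> where "\<B> = blk ` \<V>"
  have self: "V \<subseteq> blk V" for V by (auto simp: blk_def)
  have opn: "openin X (blk V)" if "V \<in> \<V>" for V
    using rV that \<V>(1) by (auto simp: blk_def)
  have un: "\<Union>\<B> = topspace X"
  proof
    show "\<Union>\<B> \<subseteq> topspace X"
      unfolding \<B>_def by (rule UN_least) (rule openin_subset[OF opn])
    show "topspace X \<subseteq> \<Union>\<B>"
      unfolding \<B>_def \<V>(2)[symmetric] using self by blast
  qed
  have dj: "disjoint \<B>" unfolding disjoint_def \<B>_def using blk_eq by blast
  have ne: "{} \<notin> \<B>" using self by (auto simp: \<B>_def \<V>_def)
  have lin: "Lindelof_space (subtopology X (blk V))" if V: "V \<in> \<V>" for V
  proof -
    \<comment> \<open>The complement of a block is the union of the other blocks, so the block is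
      closed and contains the closures of its members. It is therefore a countable union of Lindelof
      closures.\<close>
    have "topspace X - blk V = \<Union>{blk W | W. W \<in> \<V> \<and> blk W \<noteq> blk V}"
    proof
      show "topspace X - blk V \<subseteq> \<Union>{blk W | W. W \<in> \<V> \<and> blk W \<noteq> blk V}"
        unfolding un[symmetric] \<B>_def by auto
      show "\<Union>{blk W | W. W \<in> \<V> \<and> blk W \<noteq> blk V} \<subseteq> topspace X - blk V"
      proof (rule Union_least)
        fix S assume "S \<in> {blk W | W. W \<in> \<V> \<and> blk W \<noteq> blk V}"
        then obtain W where W: "S = blk W" "W \<in> \<V>" "blk W \<noteq> blk V" by auto
        then have "blk W \<inter> blk V = {}" using blk_eq[OF W(2) V] by auto
        then show "S \<subseteq> topspace X - blk V" using openin_subset[OF opn[OF W(2)]] W(1) by blast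
      qed
    qed
    moreover have "openin X (\<Union>{blk W | W. W \<in> \<V> \<and> blk W \<noteq> blk V})"
      by (rule openin_Union) (use opn in auto)
    ultimately have "openin X (topspace X - blk V)" by simp
    then have clo: "closedin X (blk V)" using opn[OF V] by (simp add: closedin_def openin_subset)
    have "W \<subseteq> X closure_of W \<and> X closure_of W \<subseteq> blk V" if W: "(V, W) \<in> r\<^sup>*" for W
    proof
      show "W \<subseteq> X closure_of W"
        using \<V>(1)[OF rV[OF W V]] by (simp add: closure_of_subset openin_subset)
      show "X closure_of W \<subseteq> blk V"
        using W by (intro closure_of_minimal clo) (auto simp: blk_def)
    qed
    then have eq: "blk V = \<Union>((\<lambda>W. X closure_of W) ` (r\<^sup>* `` {V}))"
      unfolding blk_def by blast
    have "Lindelof_space (subtopology X U)" if "U \<in> (\<lambda>W. X closure_of W) ` (r\<^sup>* `` {V})" for U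
      using that LV rV[OF _ V] by auto
    then show ?thesis
      unfolding eq using Lindelof_space_Union[of "(\<lambda>W. X closure_of W) ` (r\<^sup>* `` {V})" X] rs by blast
  qed
  have "openin X B" "Lindelof_space (subtopology X B)" if "B \<in> \<B>" for B
    using that opn lin by (auto simp: \<B>_def)
  then show ?thesis using that[of \<B>] un dj ne by blast
qed

section \<open>The Stone--Cech compactification and its clopen subsets\<close>

lemma Hausdorff_unit_cube: "Hausdorff_space (unit_cube X)"
  unfolding unit_cube_def Hausdorff_space_product_topology
  by (simp add: Hausdorff_space_subtopology)

lemma compact_unit_cube: "compact_space (unit_cube X)"
  unfolding unit_cube_def compact_space_product_topology
  by (simp add: compact_space_subtopology)

lemma Hausdorff_beta: "Hausdorff_space (beta X)"
  unfolding beta_def by (intro Hausdorff_space_subtopology Hausdorff_unit_cube)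

lemma compact_beta: "compact_space (beta X)"
  unfolding beta_def
  by (intro compact_space_subtopology closedin_compact_space compact_unit_cube closedin_closure_of)

lemma continuous_map_beta_embed_cube: "continuous_map X (unit_cube X) (beta_embed X)"
  unfolding unit_cube_def continuous_map_componentwise
proof (intro conjI ballI)
  fix f assume f: "f \<in> unit_funs X"
  then have "continuous_map X (top_of_set {0..1}) f"
    by (auto simp: unit_funs_def C_b_def continuous_map_in_subtopology)
  then show "continuous_map X (top_of_set {0..1}) (\<lambda>x. beta_embed X x f)"
    using f by (simp add: beta_embed_def)
qed (auto simp: beta_embed_def)

lemma topspace_beta: "topspace (beta X) = unit_cube X closure_of (beta_embed X ` topspace X)"
  unfolding beta_def by (simp add: closure_of_subset_topspace Int_absorb1)

lemma beta_embed_in_beta: "x \<in> topspace X \<Longrightarrow> beta_embed X x \<in> topspace (beta X)"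
  unfolding topspace_beta
  by (rule subsetD[OF closure_of_subset[OF continuous_map_image_subset_topspace[OF continuous_map_beta_embed_cube]]]) simp

lemma continuous_map_beta_embed: "continuous_map X (beta X) (beta_embed X)"
  unfolding beta_def continuous_map_in_subtopology
  using continuous_map_beta_embed_cube beta_embed_in_beta by (force simp: topspace_beta)

lemma beta_dense: "beta X closure_of (beta_embed X ` topspace X) = topspace (beta X)"
proof -
  have "beta_embed X ` topspace X \<subseteq> topspace (beta X)" using beta_embed_in_beta by auto
  then have "beta X closure_of (beta_embed X ` topspace X)
      = topspace (beta X) \<inter> unit_cube X closure_of (beta_embed X ` topspace X)"
    unfolding topspace_beta by (simp add: beta_def closure_of_subtopology Int_absorb1)
  then show ?thesis by (simp add: topspace_beta)
qed

lemma continuous_map_beta_eval: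
  assumes "f \<in> unit_funs X"
  shows "continuous_map (beta X) euclideanreal (\<lambda>p. p f)"
proof -
  have "continuous_map (unit_cube X) (top_of_set {0..1}) (\<lambda>p. p f)"
    unfolding unit_cube_def using assms by (rule continuous_map_product_projection)
  then have "continuous_map (unit_cube X) euclideanreal (\<lambda>p. p f)"
    by (simp add: continuous_map_in_subtopology)
  then show ?thesis unfolding beta_def by (rule continuous_map_from_subtopology)
qed

lemma beta_embed_eval: "f \<in> unit_funs X \<Longrightarrow> beta_embed X x f = f x"
  by (simp add: beta_embed_def)

lemma beta_dense_induct:
  assumes "closedin (beta X) {p \<in> topspace (beta X). P p}"
    and "\<And>x. x \<in> topspace X \<Longrightarrow> P (beta_embed X x)" and p: "p \<in> topspace (beta X)"
  shows "P p"
  using p forall_in_closure_of[of p "beta X" "beta_embed X ` topspace X" P] assms(1,2)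
  unfolding beta_dense by blast

section \<open>Continuous scalar functions and their extension to \<open>beta X\<close>\<close>

lemma continuous_map_add_normed:
  fixes f g :: "'a \<Rightarrow> 'k::real_normed_vector"
  shows "\<lbrakk>continuous_map X euclidean f; continuous_map X euclidean g\<rbrakk>
    \<Longrightarrow> continuous_map X euclidean (\<lambda>x. f x + g x)"
  by (simp add: continuous_map_atin tendsto_add)

lemma continuous_map_mult_normed:
  fixes f g :: "'a \<Rightarrow> 'k::real_normed_algebra"
  shows "\<lbrakk>continuous_map X euclidean f; continuous_map X euclidean g\<rbrakk>
    \<Longrightarrow> continuous_map X euclidean (\<lambda>x. f x * g x)"
  by (simp add: continuous_map_atin tendsto_mult)

lemma continuous_map_postcompose:
  assumes "continuous_map X euclidean f" "continuous_on UNIV h"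
  shows "continuous_map X euclidean (\<lambda>x. h (f x))"
proof -
  have "continuous_map euclidean euclidean h" using assms(2) by simp
  from continuous_map_compose[OF assms(1) this] show ?thesis by (simp add: o_def)
qed

text \<open>Each Euclidean component of \<open>f\<close>, rescaled affinely from
  \<open>[-M, M]\<close> to \<open>[0, 1]\<close>, is one of the functions indexing the cube. A
  point \<open>p\<close> therefore already carries a value for it, and \<open>F p\<close> undoes the
  rescaling and reassembles the components.\<close>

lemma C_b_extends_to_beta:
  fixes f :: "'a \<Rightarrow> 'k::{real_normed_field, euclidean_space}"
  assumes f: "f \<in> C_b X"
  obtains F where "continuous_map (beta X) euclidean F"
    "\<And>x. x \<in> topspace X \<Longrightarrow> F (beta_embed X x) = f x"
proof -
  obtain M where M: "M > 0" "\<And>x. x \<in> topspace X \<Longrightarrow> norm (f x) \<le> M"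
    using f unfolding C_b_def bounded_pos by auto
  define g where "g b x = (if x \<in> topspace X then (f x \<bullet> b + M) / (2 * M) else 0)" for b x
  have g: "g b \<in> unit_funs X" if "b \<in> Basis" for b
  proof -
    have cf: "continuous_map X euclidean f" using f by (simp add: C_b_def)
    have "continuous_map X euclideanreal (\<lambda>x. (\<lambda>v. (v \<bullet> b + M) / (2 * M)) (f x))"
      by (rule continuous_map_postcompose[OF cf]) (use M in \<open>auto intro!: continuous_intros\<close>)
    then have "continuous_map X euclideanreal (g b)"
      by (rule continuous_map_eq) (simp add: g_def)
    moreover have im: "g b ` topspace X \<subseteq> {0..1}"
    proof (clarsimp simp: g_def)
      fix x assume x: "x \<in> topspace X"
      have "\<bar>f x \<bullet> b\<bar> \<le> M" using M(2)[OF x] Basis_le_norm[OF that, of "f x"] by simp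
      then show "0 \<le> (f x \<bullet> b + M) / (2 * M) \<and> (f x \<bullet> b + M) / (2 * M) \<le> 1"
        using M(1) by (auto simp: field_simps)
    qed
    moreover have "bounded (g b ` topspace X)" by (rule bounded_subset[OF _ im]) simp
    ultimately show ?thesis by (auto simp: unit_funs_def C_b_def g_def)
  qed
  define F where "F p = (\<Sum>b\<in>Basis. (2 * M * p (g b) - M) *\<^sub>R b)" for p :: "('a \<Rightarrow> real) \<Rightarrow> real"
  have "((\<lambda>p. \<Sum>b\<in>Basis. (2 * M * p (g b) - M) *\<^sub>R b) \<longlongrightarrow> (\<Sum>b\<in>Basis. (2 * M * q (g b) - M) *\<^sub>R b))
      (atin (beta X) q)" if "q \<in> topspace (beta X)" for q
    using continuous_map_beta_eval[OF g] that
    by (intro tendsto_intros) (simp add: continuous_map_atin)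
  then have "continuous_map (beta X) euclidean F"
    unfolding F_def continuous_map_atin by simp
  moreover have "F (beta_embed X x) = f x" if x: "x \<in> topspace X" for x
  proof -
    have "F (beta_embed X x) = (\<Sum>b\<in>Basis. (f x \<bullet> b) *\<^sub>R b)"
      unfolding F_def using x M(1) by (intro sum.cong) (auto simp: beta_embed_eval[OF g] g_def)
    then show ?thesis by (simp add: euclidean_representation)
  qed
  ultimately show ?thesis using that by blast
qed

lemma continuous_map_indicator_clopen:
  fixes c :: "'k::real_normed_field"
  assumes "openin X S" "closedin X S"
  shows "continuous_map X euclidean (\<lambda>x. if x \<in> S then c else 0)"
proof -
  have "{x \<in> topspace X. (if x \<in> S then c else 0) \<in> U}
     = (if c \<in> U then S else {}) \<union> (if 0 \<in> U then topspace X - S else {})" for U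
    using openin_subset[OF assms(1)] by auto
  then show ?thesis using assms unfolding continuous_map_def by auto
qed

lemma indicator_clopen_in_C_b:
  fixes c :: "'k::real_normed_field"
  assumes "openin X S" "closedin X S"
  shows "(\<lambda>x. if x \<in> S then c else 0) \<in> C_b X"
proof -
  have "(\<lambda>x. if x \<in> S then c else 0) ` topspace X \<subseteq> {0, c}" by auto
  then have "bounded ((\<lambda>x. if x \<in> S then c else 0) ` topspace X)"
    by (rule bounded_subset[rotated]) simp
  then show ?thesis
    using continuous_map_indicator_clopen[OF assms, of c] openin_subset[OF assms(1)]
    by (auto simp: C_b_def)
qed

text \<open>The closure of \<open>S\<close> in \<open>beta X\<close> when \<open>S\<close> is
  clopen, encoded through the coordinate of \<open>p\<close> at the indicator of \<open>S\<close>.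
  That coordinate is continuous and takes only the values 0 and 1, so the set is clopen at
  once.\<close>

definition clopen_ext :: "'a topology \<Rightarrow> 'a set \<Rightarrow> (('a \<Rightarrow> real) \<Rightarrow> real) set" where
  "clopen_ext X S = {p \<in> topspace (beta X). p (\<lambda>x. if x \<in> S then 1 else 0) = 1}"

lemma indicator_clopen_in_unit_funs:
  assumes "openin X S" "closedin X S"
  shows "(\<lambda>x. if x \<in> S then 1 else 0) \<in> unit_funs X"
  using indicator_clopen_in_C_b[OF assms, of "1::real"] by (auto simp: unit_funs_def)

lemma clopen_ext_eval_cases:
  assumes "openin X S" "closedin X S" "p \<in> topspace (beta X)"
  shows "p (\<lambda>x. if x \<in> S then 1 else 0) \<in> {0, 1}"
  using _ _ assms(3)
proof (rule beta_dense_induct)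
  show "closedin (beta X) {p \<in> topspace (beta X). p (\<lambda>x. if x \<in> S then 1 else 0) \<in> {0, 1}}"
    using closedin_continuous_map_preimage[OF continuous_map_beta_eval[OF indicator_clopen_in_unit_funs[OF assms(1,2)]], of "{0, 1}"]
    by simp
qed (simp add: beta_embed_eval indicator_clopen_in_unit_funs assms)

lemma closedin_clopen_ext:
  assumes "openin X S" "closedin X S"
  shows "closedin (beta X) (clopen_ext X S)"
  using closedin_continuous_map_preimage[OF continuous_map_beta_eval[OF indicator_clopen_in_unit_funs[OF assms]], of "{1}"]
  by (simp add: clopen_ext_def)

lemma openin_clopen_ext:
  assumes "openin X S" "closedin X S"
  shows "openin (beta X) (clopen_ext X S)"
proof -
  have "clopen_ext X S = {p \<in> topspace (beta X). p (\<lambda>x. if x \<in> S then 1 else 0) \<in> {0<..}}"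
    using clopen_ext_eval_cases[OF assms] by (force simp: clopen_ext_def)
  then show ?thesis
    using openin_continuous_map_preimage[OF continuous_map_beta_eval[OF indicator_clopen_in_unit_funs[OF assms]], of "{0<..}"]
    by simp
qed

lemma beta_embed_in_clopen_ext:
  assumes "openin X S" "closedin X S" "x \<in> topspace X"
  shows "beta_embed X x \<in> clopen_ext X S \<longleftrightarrow> x \<in> S"
  using assms by (simp add: clopen_ext_def beta_embed_in_beta beta_embed_eval indicator_clopen_in_unit_funs)

text \<open>An open subset of \<open>beta X\<close> lies in the closure of its trace on the dense
  image of \<open>X\<close>, and the trace of \<open>clopen_ext X S\<close> is the image of
  \<open>S\<close>.\<close>

lemma beta_closure_of_clopen:
  assumes "openin X S" "closedin X S"
  shows "beta X closure_of (beta_embed X ` S) = clopen_ext X S"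
proof
  have S: "S \<subseteq> topspace X" using assms openin_subset by auto
  show "beta X closure_of (beta_embed X ` S) \<subseteq> clopen_ext X S"
    using S beta_embed_in_clopen_ext[OF assms] by (intro closure_of_minimal closedin_clopen_ext assms) auto
  have "clopen_ext X S \<inter> beta_embed X ` topspace X \<subseteq> beta_embed X ` S"
    using beta_embed_in_clopen_ext[OF assms] by auto
  then have "beta X closure_of (clopen_ext X S \<inter> beta_embed X ` topspace X) \<subseteq> beta X closure_of (beta_embed X ` S)"
    by (rule closure_of_mono)
  then show "clopen_ext X S \<subseteq> beta X closure_of (beta_embed X ` S)"
    using openin_Int_closure_of_subset[OF openin_clopen_ext[OF assms], of "beta_embed X ` topspace X"]
    unfolding beta_dense by (auto simp: clopen_ext_def)
qed

lemma clopen_ext_mono: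
  assumes "openin X S" "closedin X S" "openin X T" "closedin X T" "S \<subseteq> T"
  shows "clopen_ext X S \<subseteq> clopen_ext X T"
  using beta_closure_of_clopen[OF assms(1,2)] beta_closure_of_clopen[OF assms(3,4)] assms(5)
  by (metis closure_of_mono image_mono)

lemma clopen_ext_subset: "clopen_ext X S \<subseteq> topspace (beta X)"
  by (auto simp: clopen_ext_def)

text \<open>Closures do not commute with intersections in general; here both sets are open in
  \<open>beta X\<close>, so their intersection is determined by its trace on the image of
  \<open>X\<close>.\<close>

lemma clopen_ext_Int:
  assumes "openin X S" "closedin X S" "openin X T" "closedin X T"
  shows "clopen_ext X (S \<inter> T) = clopen_ext X S \<inter> clopen_ext X T"
proof
  show "clopen_ext X (S \<inter> T) \<subseteq> clopen_ext X S \<inter> clopen_ext X T"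
    using assms by (intro Int_greatest clopen_ext_mono) auto
  have "clopen_ext X S \<inter> clopen_ext X T \<inter> topspace (beta X)
      \<subseteq> beta X closure_of (clopen_ext X S \<inter> clopen_ext X T \<inter> beta_embed X ` topspace X)"
    using openin_Int_closure_of_subset[of "beta X" "clopen_ext X S \<inter> clopen_ext X T" "beta_embed X ` topspace X"]
    unfolding beta_dense using assms by (simp add: openin_clopen_ext openin_Int)
  also have "\<dots> \<subseteq> beta X closure_of (beta_embed X ` (S \<inter> T))"
    by (rule closure_of_mono)
      (auto simp: beta_embed_in_clopen_ext[OF assms(1,2)] beta_embed_in_clopen_ext[OF assms(3,4)])
  also have "\<dots> = clopen_ext X (S \<inter> T)"
    using assms by (intro beta_closure_of_clopen) auto
  finally show "clopen_ext X S \<inter> clopen_ext X T \<subseteq> clopen_ext X (S \<inter> T)"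
    using clopen_ext_subset by blast
qed

lemma clopen_ext_Compl:
  assumes "openin X S" "closedin X S"
  shows "clopen_ext X (topspace X - S) = topspace (beta X) - clopen_ext X S"
proof
  have c: "openin X (topspace X - S)" "closedin X (topspace X - S)" using assms by auto
  have "clopen_ext X {} = {}"
    using beta_closure_of_clopen[of X "{}"] by simp
  then have "clopen_ext X (topspace X - S) \<inter> clopen_ext X S = {}"
    using clopen_ext_Int[OF c assms] by (simp add: Int_commute)
  then show "clopen_ext X (topspace X - S) \<subseteq> topspace (beta X) - clopen_ext X S"
    using clopen_ext_subset by blast
  have "beta X closure_of (beta_embed X ` topspace X) \<subseteq>
      beta X closure_of (beta_embed X ` S) \<union> beta X closure_of (beta_embed X ` (topspace X - S))"
    unfolding closure_of_Un[symmetric] by (rule closure_of_mono) blast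
  then show "topspace (beta X) - clopen_ext X S \<subseteq> clopen_ext X (topspace X - S)"
    unfolding beta_dense beta_closure_of_clopen[OF assms] beta_closure_of_clopen[OF c] by blast
qed

text \<open>A cozero-set with Lindelof closure sits inside some clopen Lindelof \<open>S\<close>.
  Conversely such an \<open>S\<close> is the cozero-set of its own indicator, and the closure of its
  image is already open, so taking the interior changes nothing.\<close>

lemma lambda_lindelof_eq:
  fixes k :: "'k::{real_normed_field} itself"
  assumes X: "regular_space X" "Hausdorff_space X"
    and sub: "\<And>L. \<lbrakk>L \<subseteq> topspace X; Lindelof_space (subtopology X L)\<rbrakk> \<Longrightarrow> \<exists>S. clopen_Lindelof X S \<and> L \<subseteq> S"
  shows "lambda_P k lindelof X = subtopology (beta X) (\<Union>{clopen_ext X S | S. clopen_Lindelof X S})"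
proof -
  have "\<Union>{beta X interior_of (beta X closure_of (beta_embed X ` C)) | C.
          C \<in> cozero_sets k X \<and> lindelof (subtopology X (X closure_of C))}
      = \<Union>{clopen_ext X S | S. clopen_Lindelof X S}" (is "?A = ?B")
  proof
    show "?A \<subseteq> ?B"
    proof (rule Union_least, clarify)
      fix C p assume C: "C \<in> cozero_sets k X" "lindelof (subtopology X (X closure_of C))"
        and p: "p \<in> beta X interior_of (beta X closure_of (beta_embed X ` C))"
      have "C \<subseteq> topspace X" using C(1) by (auto simp: cozero_sets_def Coz_def)
      then have 1: "C \<subseteq> X closure_of C" by (rule closure_of_subset)
      obtain S where S: "clopen_Lindelof X S" "X closure_of C \<subseteq> S"
        using sub[OF closure_of_subset_topspace, of C] C(2) by (auto simp: lindelof_def)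
      have "beta X closure_of (beta_embed X ` C) \<subseteq> beta X closure_of (beta_embed X ` S)"
        using 1 S(2) by (intro closure_of_mono) auto
      also have "\<dots> = clopen_ext X S"
        using S(1) by (intro beta_closure_of_clopen) (auto simp: clopen_Lindelof_def)
      finally have "p \<in> clopen_ext X S" using p interior_of_subset by (metis subsetD)
      then show "p \<in> ?B" using S(1) by blast
    qed
    show "?B \<subseteq> ?A"
    proof (rule Union_least, clarify)
      fix S p assume S: "clopen_Lindelof X S" and p: "p \<in> clopen_ext X S"
      have c: "openin X S" "closedin X S" "Lindelof_space (subtopology X S)"
        using S by (auto simp: clopen_Lindelof_def)
      have "Coz X (\<lambda>x. if x \<in> S then 1 else (0::'k)) = S"
        using openin_subset[OF c(1)] by (auto simp: Coz_def)
      then have "S \<in> cozero_sets k X"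
        unfolding cozero_sets_def using indicator_clopen_in_C_b[OF c(1,2), of "1::'k"] by (metis image_eqI)
      moreover have "lindelof (subtopology X (X closure_of S))"
        using X c by (simp add: closure_of_closedin lindelof_def regular_space_subtopology Hausdorff_space_subtopology)
      moreover have "beta X interior_of (beta X closure_of (beta_embed X ` S)) = clopen_ext X S"
        using c by (simp add: beta_closure_of_clopen interior_of_openin openin_clopen_ext)
      ultimately show "p \<in> ?A" using p by blast
    qed
  qed
  then show ?thesis by (simp add: lambda_P_def)
qed

section \<open>Algebra isomorphisms between spaces of compactly supported functions\<close>

lemma C_cD:
  assumes "f \<in> C_c X"
  shows "continuous_map X euclidean f" "\<And>x. x \<notin> topspace X \<Longrightarrow> f x = 0" "compactin X (supp X f)"
    "f \<in> C_b X"
  using assms by (auto simp: C_c_def C_b_def)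

lemma Coz_subset_supp: "Coz X f \<subseteq> supp X f"
  unfolding supp_def by (rule closure_of_subset) (auto simp: Coz_def)

lemma C_cI:
  fixes f :: "'a \<Rightarrow> 'k::real_normed_field"
  assumes X: "Hausdorff_space X" and f: "continuous_map X euclidean f" "\<And>x. x \<notin> topspace X \<Longrightarrow> f x = 0"
    and K: "compactin X K" "Coz X f \<subseteq> K"
  shows "f \<in> C_c X"
proof -
  have clo: "closedin X K" using K(1) X by (simp add: compactin_imp_closedin)
  have "supp X f \<subseteq> K" unfolding supp_def by (rule closure_of_minimal[OF K(2) clo])
  then have "compactin X (supp X f)"
    using K(1) closed_compactin[of X K "supp X f"] by (simp add: supp_def)
  moreover have "bounded (f ` topspace X)"
  proof -
    have "compactin euclidean (f ` K)" using K(1) f(1) by (rule image_compactin)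
    then have "bounded (insert 0 (f ` K))" by (simp add: compact_imp_bounded)
    then show ?thesis by (rule bounded_subset) (use K(2) in \<open>auto simp: Coz_def\<close>)
  qed
  ultimately show ?thesis using f by (auto simp: C_c_def C_b_def)
qed

lemma C_c_closed_under:
  fixes f g :: "'a \<Rightarrow> 'k::real_normed_field"
  assumes X: "Hausdorff_space X" and f: "f \<in> C_c X" and g: "g \<in> C_c X"
  shows "(\<lambda>x. f x + g x) \<in> C_c X" "(\<lambda>x. c * f x) \<in> C_c X" "(\<lambda>x. f x * g x) \<in> C_c X"
    "(\<lambda>x. 0) \<in> (C_c X :: ('a \<Rightarrow> 'k) set)"
proof -
  note C = C_cD[OF f] C_cD[OF g]
  show "(\<lambda>x. f x + g x) \<in> C_c X"
  proof (rule C_cI[OF X])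
    show "compactin X (supp X f \<union> supp X g)" using C by (simp add: compactin_Un)
    have "Coz X (\<lambda>x. f x + g x) \<subseteq> Coz X f \<union> Coz X g" by (auto simp: Coz_def)
    then show "Coz X (\<lambda>x. f x + g x) \<subseteq> supp X f \<union> supp X g"
      using Coz_subset_supp[of X f] Coz_subset_supp[of X g] by blast
  qed (use C in \<open>auto intro: continuous_map_add_normed\<close>)
  show "(\<lambda>x. c * f x) \<in> C_c X"
  proof (rule C_cI[OF X _ _ C(3)])
    show "Coz X (\<lambda>x. c * f x) \<subseteq> supp X f"
      using Coz_subset_supp[of X f] by (auto simp: Coz_def)
  qed (use C in \<open>auto intro: continuous_map_mult_normed\<close>)
  show "(\<lambda>x. f x * g x) \<in> C_c X"
  proof (rule C_cI[OF X _ _ C(3)])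
    show "Coz X (\<lambda>x. f x * g x) \<subseteq> supp X f"
      using Coz_subset_supp[of X f] by (auto simp: Coz_def)
  qed (use C in \<open>auto intro: continuous_map_mult_normed\<close>)
  show "(\<lambda>x. 0) \<in> (C_c X :: ('a \<Rightarrow> 'k) set)"
    by (rule C_cI[OF X _ _ C(3)]) (auto simp: Coz_def)
qed

text \<open>At a zero of \<open>u\<close> the HOL quotient is 0, and such a point lies outside the
  closed set \<open>supp X f\<close>, so \<open>f\<close>, and with it the quotient, vanishes on a
  whole neighbourhood. Elsewhere the quotient is continuous as usual.\<close>

lemma C_c_divide:
  fixes f u :: "'a \<Rightarrow> 'k::real_normed_field"
  assumes X: "Hausdorff_space X" and f: "f \<in> C_c X" and u: "continuous_map X euclidean u"
    and sub: "supp X f \<subseteq> Coz X u"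
  shows "(\<lambda>x. f x / u x) \<in> C_c X"
proof (rule C_cI[OF X])
  note C = C_cD[OF f]
  show "Coz X (\<lambda>x. f x / u x) \<subseteq> supp X f"
    using Coz_subset_supp[of X f] by (auto simp: Coz_def)
  show "continuous_map X euclidean (\<lambda>x. f x / u x)"
    unfolding continuous_map_atin
  proof
    fix x assume x: "x \<in> topspace X"
    show "limitin euclidean (\<lambda>x. f x / u x) (f x / u x) (atin X x)"
    proof (cases "u x = 0")
      case False
      then show ?thesis
        using x C(1) u by (simp add: continuous_map_atin tendsto_divide)
    next
      case True
      then have xs: "x \<in> topspace X - supp X f" using sub x by (auto simp: Coz_def)
      have "openin X (topspace X - supp X f)" by (simp add: supp_def openin_diff)
      then have "eventually (\<lambda>y. y \<in> topspace X - supp X f) (atin X x)"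
        using xs unfolding eventually_atin by blast
      then have "eventually (\<lambda>y. f y / u y = 0) (atin X x)"
        by (rule eventually_mono) (use Coz_subset_supp[of X f] in \<open>auto simp: Coz_def\<close>)
      then show ?thesis using True by (simp add: tendsto_eventually)
    qed
  qed
qed (use C_cD[OF f] in auto)

text \<open>Complete regularity gives a function that is 0 at \<open>z\<close> and 1 off
  \<open>V\<close>; one minus it is supported in the closed compact \<open>K\<close>. The bump comes
  as a nonnegative real function, embedded in the scalars, so that finite sums of bumps cannot
  cancel.\<close>

lemma locally_compact_bump:
  assumes X: "locally_compact X" and U: "openin X U" "z \<in> U"
  obtains r :: "'a \<Rightarrow> real" where "(\<lambda>x. of_real (r x)) \<in> (C_c X :: ('a \<Rightarrow> 'k::real_normed_field) set)"
    "r z = 1" "\<And>x. 0 \<le> r x" "supp X (\<lambda>x. of_real (r x) :: 'k) \<subseteq> U"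
proof -
  have H: "Hausdorff_space X" and L: "locally_compact_space X" using X by (auto simp: locally_compact_def)
  obtain V K where VK: "openin X V" "compactin X K" "closedin X K" "z \<in> V" "V \<subseteq> K" "K \<subseteq> U"
    using L H U unfolding locally_compact_space_neighbourhood_base_closedin[OF disjI1[OF H]]
      neighbourhood_base_of by metis
  have "completely_regular_space X"
    using locally_compact_regular_imp_completely_regular_space L locally_compact_Hausdorff_imp_regular_space H by blast
  moreover have "closedin X (topspace X - V)" "z \<in> topspace X - (topspace X - V)"
    using VK(1,4) openin_subset[OF VK(1)] by auto
  ultimately obtain f :: "'a \<Rightarrow> real" where f: "continuous_map X (top_of_set {0..1}) f" "f z = 0"
      "f ` (topspace X - V) \<subseteq> {1}"
    unfolding completely_regular_space_def by metis
  define r where "r x = (if x \<in> topspace X then 1 - f x else 0)" for x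
  have zt: "z \<in> topspace X" using VK openin_subset by blast
  have f01: "f x \<in> {0..1}" if "x \<in> topspace X" for x
    using f(1) that by (auto simp: continuous_map_in_subtopology)
  have cz: "Coz X (\<lambda>x. of_real (r x) :: 'k) \<subseteq> K"
    using f(3) VK(5) by (auto simp: Coz_def r_def)
  have "continuous_map X euclideanreal f" using f(1) by (simp add: continuous_map_in_subtopology)
  then have "continuous_map X euclidean (\<lambda>x. (\<lambda>t. of_real (1 - t) :: 'k) (f x))"
    by (rule continuous_map_postcompose) (auto intro!: continuous_intros)
  then have "continuous_map X euclidean (\<lambda>x. of_real (r x) :: 'k)"
    by (rule continuous_map_eq) (simp add: r_def)
  then have "(\<lambda>x. of_real (r x) :: 'k) \<in> C_c X"
    by (rule C_cI[OF H _ _ VK(2) cz]) (simp add: r_def)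
  moreover have "supp X (\<lambda>x. of_real (r x) :: 'k) \<subseteq> U"
    unfolding supp_def using closure_of_minimal[OF cz VK(3)] VK(6) by blast
  moreover have "0 \<le> r x" for x using f01[of x] by (auto simp: r_def)
  ultimately show ?thesis using that[of r] f(2) zt by (simp add: r_def)
qed

text \<open>The kernel of a character is an ideal. If it had no common zero, then it would contain small
  bump functions around every point, hence a function that is positive on any given compact set,
  hence everything.\<close>

lemma C_c_character:
  fixes \<phi> :: "('a \<Rightarrow> 'k::real_normed_field) \<Rightarrow> 'k"
  assumes X: "locally_compact X"
    and add: "\<And>f g. \<lbrakk>f \<in> C_c X; g \<in> C_c X\<rbrakk> \<Longrightarrow> \<phi> (\<lambda>x. f x + g x) = \<phi> f + \<phi> g"
    and scale: "\<And>c f. f \<in> C_c X \<Longrightarrow> \<phi> (\<lambda>x. c * f x) = c * \<phi> f"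
    and mult: "\<And>f g. \<lbrakk>f \<in> C_c X; g \<in> C_c X\<rbrakk> \<Longrightarrow> \<phi> (\<lambda>x. f x * g x) = \<phi> f * \<phi> g"
    and nz: "f0 \<in> C_c X" "\<phi> f0 \<noteq> 0"
  obtains z where "z \<in> topspace X" "\<And>f. f \<in> C_c X \<Longrightarrow> \<phi> f = f z"
proof -
  have H: "Hausdorff_space X" using X by (auto simp: locally_compact_def)
  note cl = C_c_closed_under[OF H]
  have "\<exists>z\<in>topspace X. \<forall>f\<in>C_c X. \<phi> f = 0 \<longrightarrow> f z = 0"
  proof (rule ccontr)
    assume "\<not> ?thesis"
    then have ex: "\<exists>f\<in>C_c X. \<phi> f = 0 \<and> f z \<noteq> 0" if "z \<in> topspace X" for z using that by blast
    have "\<exists>r. (\<lambda>x. of_real (r x)) \<in> (C_c X :: ('a \<Rightarrow> 'k) set) \<and> r z = 1 \<and> (\<forall>x. 0 \<le> r x)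
        \<and> \<phi> (\<lambda>x. of_real (r x)) = 0" if z: "z \<in> topspace X" for z
    proof -
      obtain f where f: "f \<in> C_c X" "\<phi> f = 0" "f z \<noteq> 0" using ex[OF z] by blast
      have "openin X {x \<in> topspace X. f x \<in> - {0}}"
        by (rule openin_continuous_map_preimage[OF C_cD(1)[OF f(1)]]) auto
      moreover have "{x \<in> topspace X. f x \<in> - {0}} = Coz X f" by (auto simp: Coz_def)
      ultimately have "openin X (Coz X f)" by simp
      moreover have "z \<in> Coz X f" using z f(3) by (simp add: Coz_def)
      ultimately obtain r where r: "(\<lambda>x. of_real (r x)) \<in> (C_c X :: ('a \<Rightarrow> 'k) set)" "r z = 1"
          "\<And>x. 0 \<le> r x" "supp X (\<lambda>x. of_real (r x) :: 'k) \<subseteq> Coz X f"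
        using locally_compact_bump[OF X, where 'k='k] by metis
      \<comment> \<open>This is where the support of the bump, not only its cozero-set, has to lie
        in \<open>Coz X f\<close>: the quotient is then an element of the algebra, and the bump is a
        multiple of the kernel element \<open>f\<close>.\<close>
      have d: "(\<lambda>x. of_real (r x) / f x) \<in> C_c X"
        by (rule C_c_divide[OF H r(1) C_cD(1)[OF f(1)] r(4)])
      have "of_real (r x) = f x * (of_real (r x) / f x)" for x
        using r(4) Coz_subset_supp[of X "\<lambda>x. of_real (r x) :: 'k"] C_cD(2)[OF r(1), of x]
        by (auto simp: Coz_def)
      then have "(\<lambda>x. of_real (r x)) = (\<lambda>x. f x * (of_real (r x) / f x))" by blast
      then have "\<phi> (\<lambda>x. of_real (r x)) = 0" using mult[OF f(1) d] f(2) by simp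
      then show ?thesis using r by blast
    qed
    then obtain R where R: "\<And>z. z \<in> topspace X \<Longrightarrow> (\<lambda>x. of_real (R z x)) \<in> (C_c X :: ('a \<Rightarrow> 'k) set)"
      "\<And>z. z \<in> topspace X \<Longrightarrow> R z z = 1" "\<And>z x. z \<in> topspace X \<Longrightarrow> 0 \<le> R z x"
      "\<And>z. z \<in> topspace X \<Longrightarrow> \<phi> (\<lambda>x. of_real (R z x)) = 0" by metis
    define G where "G z = {x \<in> topspace X. (of_real (R z x) :: 'k) \<in> - {0}}" for z
    have Gop: "openin X (G z)" if "z \<in> topspace X" for z
      unfolding G_def by (rule openin_continuous_map_preimage[OF C_cD(1)[OF R(1)[OF that]]]) auto
    have K: "compactin X (supp X f0)" "supp X f0 \<subseteq> topspace X"
      using C_cD(3)[OF nz(1)] compactin_subset_topspace by auto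
    have "\<exists>F. finite F \<and> F \<subseteq> G ` topspace X \<and> supp X f0 \<subseteq> \<Union>F"
      using K(1) unfolding compactin_def
    proof (elim conjE allE[of _ "G ` topspace X"] impE)
      have "z \<in> G z" if "z \<in> topspace X" for z using that R(2) by (simp add: G_def)
      then show "Ball (G ` topspace X) (openin X) \<and> supp X f0 \<subseteq> \<Union> (G ` topspace X)"
        using Gop K(2) by blast
    qed auto
    then obtain F where F: "finite F" "F \<subseteq> topspace X" "supp X f0 \<subseteq> \<Union>(G ` F)"
      by (metis finite_subset_image)
    define s where "s x = (\<Sum>z\<in>F. R z x)" for x
    have "(\<lambda>x. of_real (\<Sum>z\<in>F'. R z x) :: 'k) \<in> C_c X \<and> \<phi> (\<lambda>x. of_real (\<Sum>z\<in>F'. R z x)) = 0"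
      if "F' \<subseteq> F" for F'
      using finite_subset[OF that F(1)] that
    proof (induction F' rule: finite_induct)
      case empty
      have "\<phi> (\<lambda>x. 0) = 0" using scale[OF nz(1), of 0] by simp
      then show ?case using cl(4)[OF nz(1) nz(1)] by simp
    next
      case (insert z F')
      then have IH: "(\<lambda>x. of_real (\<Sum>z\<in>F'. R z x) :: 'k) \<in> C_c X"
        "\<phi> (\<lambda>x. of_real (\<Sum>z\<in>F'. R z x)) = 0" and z: "z \<in> topspace X" using F(2) by auto
      have "(\<lambda>x. of_real (\<Sum>z\<in>insert z F'. R z x) :: 'k)
          = (\<lambda>x. of_real (R z x) + of_real (\<Sum>z\<in>F'. R z x))"
        using insert.hyps by simp
      then show ?case using cl(1)[OF R(1)[OF z] IH(1)] add[OF R(1)[OF z] IH(1)] R(4)[OF z] IH(2) by simp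
    qed
    from this[of F] have s: "(\<lambda>x. of_real (s x) :: 'k) \<in> C_c X" "\<phi> (\<lambda>x. of_real (s x)) = 0"
      by (auto simp: s_def)
    \<comment> \<open>One summand is strictly positive at \<open>x\<close> and the others are
      nonnegative, so \<open>s\<close> can be divided by on the support of \<open>f0\<close>;
      \<open>f0\<close> thus becomes a multiple of a kernel element.\<close>
    have "s x > 0" if "x \<in> supp X f0" for x
    proof -
      obtain z where z: "z \<in> F" "x \<in> G z" using F(3) \<open>x \<in> supp X f0\<close> by blast
      then have "R z x > 0" using R(3)[of z x] F(2) by (auto simp: G_def less_le)
      then show ?thesis unfolding s_def using F z(1) R(3) by (intro sum_pos2[of F z]) auto
    qed
    then have sub: "supp X f0 \<subseteq> Coz X (\<lambda>x. of_real (s x) :: 'k)"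
      using K(2) by (force simp: Coz_def)
    have d: "(\<lambda>x. f0 x / of_real (s x)) \<in> C_c X"
      by (rule C_c_divide[OF H nz(1) C_cD(1)[OF s(1)] sub])
    have "f0 x = of_real (s x) * (f0 x / of_real (s x))" for x
      using sub Coz_subset_supp[of X f0] C_cD(2)[OF nz(1), of x] by (auto simp: Coz_def)
    then have "f0 = (\<lambda>x. of_real (s x) * (f0 x / of_real (s x)))" by blast
    then show False using mult[OF s(1) d] s(2) nz(2) by simp
  qed
  then obtain z where z: "z \<in> topspace X" "\<And>f. \<lbrakk>f \<in> C_c X; \<phi> f = 0\<rbrakk> \<Longrightarrow> f z = 0" by blast
  \<comment> \<open>Normalising \<open>f0\<close> gives \<open>\<phi> e = 1\<close>, so
    \<open>f - \<phi> f * e\<close> is in the kernel and vanishes at \<open>z\<close>; hence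
    \<open>f z = \<phi> f * e z\<close>. A bump at \<open>z\<close> shows that \<open>e z\<close> is
    nonzero, multiplicativity that it is idempotent, so it is 1.\<close>
  define e where "e = (\<lambda>x. inverse (\<phi> f0) * f0 x)"
  have e: "e \<in> C_c X" "\<phi> e = 1"
    using cl(2)[OF nz(1) nz(1)] scale[OF nz(1)] nz(2) by (simp_all add: e_def)
  have ev: "f z = \<phi> f * e z" if f: "f \<in> C_c X" for f
  proof -
    have 1: "(\<lambda>x. (- \<phi> f) * e x) \<in> C_c X" using cl(2)[OF e(1) e(1)] .
    have "\<phi> (\<lambda>x. f x + (- \<phi> f) * e x) = 0" using add[OF f 1] scale[OF e(1), of "- \<phi> f"] e(2) by simp
    from z(2)[OF cl(1)[OF f 1] this] show ?thesis by simp
  qed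
  obtain r where "(\<lambda>x. of_real (r x)) \<in> (C_c X :: ('a \<Rightarrow> 'k) set)" "r z = 1"
    using locally_compact_bump[OF X openin_topspace z(1), where 'k='k] by metis
  then have "e z \<noteq> 0" using ev by fastforce
  moreover have "e z * e z = e z"
    using ev[OF cl(3)[OF e(1) e(1)]] mult[OF e(1) e(1)] e(2) by simp
  ultimately have "e z = 1" by simp
  then show ?thesis using that[OF z(1)] ev by simp
qed

text \<open>For fixed \<open>y\<close> the map sending \<open>f\<close> to \<open>T f y\<close> is a
  character, nonzero since some \<open>f0\<close> is mapped to a bump at \<open>y\<close>;
  \<open>\<tau> y\<close> is its point. For continuity, a bump \<open>r\<close> supported in
  \<open>U\<close> makes the cozero-set of \<open>T r\<close> an open neighbourhood of
  \<open>y\<close> that \<open>\<tau>\<close> sends into \<open>U\<close>.\<close>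

lemma C_c_homomorphism_induced_map:
  fixes T :: "('a \<Rightarrow> 'k::real_normed_field) \<Rightarrow> ('b \<Rightarrow> 'k)"
  assumes X: "locally_compact X" and Y: "locally_compact Y"
    and bij: "bij_betw T (C_c X) (C_c Y)"
    and add: "\<And>f g. \<lbrakk>f \<in> C_c X; g \<in> C_c X\<rbrakk> \<Longrightarrow> T (\<lambda>x. f x + g x) = (\<lambda>y. T f y + T g y)"
    and scale: "\<And>c f. f \<in> C_c X \<Longrightarrow> T (\<lambda>x. c * f x) = (\<lambda>y. c * T f y)"
    and mult: "\<And>f g. \<lbrakk>f \<in> C_c X; g \<in> C_c X\<rbrakk> \<Longrightarrow> T (\<lambda>x. f x * g x) = (\<lambda>y. T f y * T g y)"
  obtains \<tau> where "continuous_map Y X \<tau>" "\<And>f y. \<lbrakk>f \<in> C_c X; y \<in> topspace Y\<rbrakk> \<Longrightarrow> T f y = f (\<tau> y)"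
proof -
  have "\<exists>x. x \<in> topspace X \<and> (\<forall>f\<in>C_c X. T f y = f x)" if y: "y \<in> topspace Y" for y
  proof -
    obtain r where r: "(\<lambda>x. of_real (r x)) \<in> (C_c Y :: ('b \<Rightarrow> 'k) set)" "r y = 1"
      using locally_compact_bump[OF Y openin_topspace y, where 'k='k] by metis
    then obtain f0 where f0: "f0 \<in> C_c X" "T f0 = (\<lambda>x. of_real (r x))"
      using bij unfolding bij_betw_def by (metis imageE)
    show ?thesis
      by (rule C_c_character[OF X, of "\<lambda>f. T f y" f0]) (use add scale mult f0 r(2) in auto)
  qed
  then obtain \<tau> where \<tau>: "\<And>y. y \<in> topspace Y \<Longrightarrow> \<tau> y \<in> topspace X"
      "\<And>f y. \<lbrakk>f \<in> C_c X; y \<in> topspace Y\<rbrakk> \<Longrightarrow> T f y = f (\<tau> y)" by metis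
  have "openin Y {y \<in> topspace Y. \<tau> y \<in> U}" if U: "openin X U" for U
  proof (subst openin_subopen, intro ballI)
    fix y assume y: "y \<in> {y \<in> topspace Y. \<tau> y \<in> U}"
    then have "\<tau> y \<in> U" by simp
    then obtain r where r: "(\<lambda>x. of_real (r x)) \<in> (C_c X :: ('a \<Rightarrow> 'k) set)" "r (\<tau> y) = 1"
        "supp X (\<lambda>x. of_real (r x) :: 'k) \<subseteq> U"
      using locally_compact_bump[OF X U, of "\<tau> y", where 'k='k] by metis
    have Tr: "T (\<lambda>x. of_real (r x)) \<in> C_c Y" using bij r(1) by (auto simp: bij_betw_def)
    have "openin Y {y \<in> topspace Y. T (\<lambda>x. of_real (r x)) y \<in> - {0}}"
      by (rule openin_continuous_map_preimage[OF C_cD(1)[OF Tr]]) auto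
    moreover have "y \<in> {y \<in> topspace Y. T (\<lambda>x. of_real (r x)) y \<in> - {0}}"
      using y r \<tau>(2)[OF r(1)] by simp
    moreover have "{y \<in> topspace Y. T (\<lambda>x. of_real (r x)) y \<in> - {0}} \<subseteq> {y \<in> topspace Y. \<tau> y \<in> U}"
    proof
      fix y' assume "y' \<in> {y \<in> topspace Y. T (\<lambda>x. of_real (r x)) y \<in> - {0}}"
      then have y': "y' \<in> topspace Y" "T (\<lambda>x. of_real (r x)) y' \<in> - {0}" by auto
      then have "\<tau> y' \<in> Coz X (\<lambda>x. of_real (r x) :: 'k)"
        using \<tau>(1) \<tau>(2)[OF r(1)] by (auto simp: Coz_def)
      then show "y' \<in> {y \<in> topspace Y. \<tau> y \<in> U}"
        using r(3) Coz_subset_supp[of X "\<lambda>x. of_real (r x) :: 'k"] y'(1) by blast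
    qed
    ultimately show "\<exists>V. openin Y V \<and> y \<in> V \<and> V \<subseteq> {y \<in> topspace Y. \<tau> y \<in> U}" by blast
  qed
  then have "continuous_map Y X \<tau>" using \<tau>(1) by (auto simp: continuous_map_def)
  then show ?thesis using that \<tau>(2) by blast
qed

lemma C_c_separates_points:
  assumes W: "locally_compact W" and pq: "p \<in> topspace W" "q \<in> topspace W"
    and eq: "\<And>f. f \<in> (C_c W :: ('a \<Rightarrow> 'k::real_normed_field) set) \<Longrightarrow> f p = f q"
  shows "p = q"
proof (rule ccontr)
  assume ne: "p \<noteq> q"
  have "closedin W {q}" using W pq by (simp add: locally_compact_def closedin_Hausdorff_singleton)
  then have o: "openin W (topspace W - {q})" by auto
  have p': "p \<in> topspace W - {q}" using ne pq by auto
  obtain r where r: "(\<lambda>x. of_real (r x)) \<in> (C_c W :: ('a \<Rightarrow> 'k) set)" "r p = 1"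
      "supp W (\<lambda>x. of_real (r x) :: 'k) \<subseteq> topspace W - {q}"
    using locally_compact_bump[OF W o p', where 'k='k] by metis
  then have "q \<notin> Coz W (\<lambda>x. of_real (r x) :: 'k)"
    using Coz_subset_supp[of W "\<lambda>x. of_real (r x) :: 'k"] by auto
  then show False using eq[OF r(1)] r(2) pq(2) by (simp add: Coz_def)
qed

text \<open>\<open>T\<close> and its inverse each induce a continuous map; the two maps are mutually
  inverse because compactly supported functions separate points.\<close>

lemma C_c_isomorphic_imp_homeomorphic:
  fixes T :: "('a \<Rightarrow> 'k::real_normed_field) \<Rightarrow> ('b \<Rightarrow> 'k)"
  assumes X: "locally_compact X" and Y: "locally_compact Y"
    and bij: "bij_betw T (C_c X) (C_c Y)"
    and add: "\<And>f g. \<lbrakk>f \<in> C_c X; g \<in> C_c X\<rbrakk> \<Longrightarrow> T (\<lambda>x. f x + g x) = (\<lambda>y. T f y + T g y)"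
    and scale: "\<And>c f. f \<in> C_c X \<Longrightarrow> T (\<lambda>x. c * f x) = (\<lambda>y. c * T f y)"
    and mult: "\<And>f g. \<lbrakk>f \<in> C_c X; g \<in> C_c X\<rbrakk> \<Longrightarrow> T (\<lambda>x. f x * g x) = (\<lambda>y. T f y * T g y)"
  shows "X homeomorphic_space Y"
proof -
  define S where "S = inv_into (C_c X) T"
  have HX: "Hausdorff_space X" using X by (auto simp: locally_compact_def)
  have ST: "S (T f) = f" if "f \<in> C_c X" for f
    using bij that unfolding S_def bij_betw_def by simp
  have TS: "T (S g) = g" "S g \<in> C_c X" if "g \<in> C_c Y" for g
    using bij that unfolding S_def bij_betw_def by (simp_all add: f_inv_into_f inv_into_into)
  have bijS: "bij_betw S (C_c Y) (C_c X)" unfolding S_def by (rule bij_betw_inv_into[OF bij])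
  have S: "S (\<lambda>y. f y + g y) = (\<lambda>x. S f x + S g x)"
    "S (\<lambda>y. f y * g y) = (\<lambda>x. S f x * S g x)" if fg: "f \<in> C_c Y" "g \<in> C_c Y" for f g
    using add[OF TS(2)[OF fg(1)] TS(2)[OF fg(2)]] mult[OF TS(2)[OF fg(1)] TS(2)[OF fg(2)]]
      ST[OF C_c_closed_under(1)[OF HX TS(2)[OF fg(1)] TS(2)[OF fg(2)]]]
      ST[OF C_c_closed_under(3)[OF HX TS(2)[OF fg(1)] TS(2)[OF fg(2)]]]
    by (simp_all add: TS(1) fg)
  have Sc: "S (\<lambda>y. c * f y) = (\<lambda>x. c * S f x)" if f: "f \<in> C_c Y" for c f
    using scale[OF TS(2)[OF f], of c] ST[OF C_c_closed_under(2)[OF HX TS(2)[OF f] TS(2)[OF f], of c]]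
    by (simp add: TS(1) f)
  obtain \<tau> where \<tau>: "continuous_map Y X \<tau>" "\<And>f y. \<lbrakk>f \<in> C_c X; y \<in> topspace Y\<rbrakk> \<Longrightarrow> T f y = f (\<tau> y)"
    using C_c_homomorphism_induced_map[OF X Y bij add scale mult] by blast
  obtain \<sigma> where \<sigma>: "continuous_map X Y \<sigma>" "\<And>f x. \<lbrakk>f \<in> C_c Y; x \<in> topspace X\<rbrakk> \<Longrightarrow> S f x = f (\<sigma> x)"
    using C_c_homomorphism_induced_map[OF Y X bijS S(1) Sc S(2)] by blast
  have "\<tau> (\<sigma> x) = x" if x: "x \<in> topspace X" for x
  proof (rule C_c_separates_points[OF X, where 'k='k])
    have sx: "\<sigma> x \<in> topspace Y" using \<sigma>(1) x by (auto simp: continuous_map_def)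
    then show "\<tau> (\<sigma> x) \<in> topspace X" using \<tau>(1) by (auto simp: continuous_map_def)
    show "f (\<tau> (\<sigma> x)) = f x" if f: "f \<in> (C_c X :: ('a \<Rightarrow> 'k) set)" for f
      using \<tau>(2)[OF f sx] \<sigma>(2)[OF bij_betwE[OF bij, rule_format, OF f] x] ST[OF f] by simp
  qed (rule x)
  moreover have "\<sigma> (\<tau> y) = y" if y: "y \<in> topspace Y" for y
  proof (rule C_c_separates_points[OF Y, where 'k='k])
    have ty: "\<tau> y \<in> topspace X" using \<tau>(1) y by (auto simp: continuous_map_def)
    then show "\<sigma> (\<tau> y) \<in> topspace Y" using \<sigma>(1) by (auto simp: continuous_map_def)
    show "f (\<sigma> (\<tau> y)) = f y" if f: "f \<in> (C_c Y :: ('b \<Rightarrow> 'k) set)" for f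
      using \<sigma>(2)[OF f ty] \<tau>(2)[OF TS(2)[OF f] y] TS(1)[OF f] by simp
  qed (rule y)
  ultimately show ?thesis
    unfolding homeomorphic_space_def homeomorphic_maps_def using \<sigma>(1) \<tau>(1) by blast
qed

section \<open>Non-normality\<close>

unbundle cardinal_syntax

text \<open>Stratified by cardinality: a nonempty set with at most \<open>n + 1\<close> elements
  arises by inserting one element into a set with at most \<open>n\<close>, so each stratum is
  bounded by \<open>A \<times> N n\<close>, and there are countably many strata.\<close>

lemma card_of_finite_subsets:
  assumes A: "infinite A"
  shows "|{F. F \<subseteq> A \<and> finite F}| \<le>o |A|"
proof -
  define N where "N n = {F. F \<subseteq> A \<and> finite F \<and> card F \<le> n}" for n :: nat
  have "|N n| \<le>o |A|" for n
  proof (induction n)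
    case 0
    have "N 0 = {{}}" by (auto simp: N_def)
    then show ?case using A by (simp add: card_of_singl_ordLeq infinite_imp_nonempty)
  next
    case (Suc n)
    have "N (Suc n) \<subseteq> N n \<union> (\<lambda>(a, F). insert a F) ` (A \<times> N n)"
    proof
      fix F assume F: "F \<in> N (Suc n)"
      show "F \<in> N n \<union> (\<lambda>(a, F). insert a F) ` (A \<times> N n)"
      proof (cases "F = {}")
        case False
        then obtain a where a: "a \<in> F" by blast
        then have "F - {a} \<in> N n" "a \<in> A" "F = insert a (F - {a})"
          using F by (auto simp: N_def card_Diff_singleton)
        then show ?thesis by (intro UnI2 image_eqI[of _ _ "(a, F - {a})"]) auto
      qed (auto simp: N_def)
    qed
    moreover have "|A \<times> N n| \<le>o |A|"
      using A Suc by (intro card_of_Times_ordLeq_infinite_Field) (simp_all add: Field_card_of card_of_card_order_on card_of_mono1)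
    then have "|(\<lambda>(a, F). insert a F) ` (A \<times> N n)| \<le>o |A|"
      using card_of_image ordLeq_transitive by blast
    then have "|N n \<union> (\<lambda>(a, F). insert a F) ` (A \<times> N n)| \<le>o |A|"
      using A Suc by (intro card_of_Un_ordLeq_infinite_Field) (simp_all add: Field_card_of card_of_card_order_on)
    ultimately show ?case using card_of_mono1 ordLeq_transitive by blast
  qed
  moreover have "|UNIV :: nat set| \<le>o |A|" using A infinite_iff_card_of_nat by blast
  ultimately have "|\<Union>n. N n| \<le>o |A|" using A by (intro card_of_UNION_ordLeq_infinite) auto
  moreover have "(\<Union>n. N n) = {F. F \<subseteq> A \<and> finite F}" by (auto simp: N_def)
  ultimately show ?thesis by simp
qed

text \<open>Hausdorff's independent family: \<open>S b\<close> consists of the codes of pairs \<open>(n, A)\<close> with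
  \<open>c b \<inter> {..<n} \<in> A\<close>.\<close>

lemma independent_family:
  fixes c :: "'i \<Rightarrow> nat set"
  assumes c: "inj_on c I"
  shows "\<exists>S :: 'i \<Rightarrow> nat set. \<forall>F G. finite F \<and> finite G \<and> F \<subseteq> I \<and> G \<subseteq> I \<and> F \<inter> G = {}
    \<longrightarrow> (\<exists>w. (\<forall>b\<in>F. w \<in> S b) \<and> (\<forall>b\<in>G. w \<notin> S b))"
proof -
  \<comment> \<open>Each \<open>n\<close> admits only finitely many families of subsets of
    \<open>{..<n}\<close>, so the pairs are countable and can be coded by naturals.\<close>
  define \<Omega> where "\<Omega> = Sigma UNIV (\<lambda>n::nat. Pow (Pow {..<n}))"
  have cnt: "countable \<Omega>" unfolding \<Omega>_def
    by (rule countable_SIGMA[OF _ countable_finite]) simp_all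
  define S where "S b = {k. c b \<inter> {..<fst (from_nat_into \<Omega> k)} \<in> snd (from_nat_into \<Omega> k)}" for b
  have "\<exists>w. (\<forall>b\<in>F. w \<in> S b) \<and> (\<forall>b\<in>G. w \<notin> S b)"
    if FG: "finite F" "finite G" "F \<subseteq> I" "G \<subseteq> I" "F \<inter> G = {}" for F G
  proof -
    have "\<exists>m. (m \<in> c b) \<noteq> (m \<in> c b')" if "b \<in> F" "b' \<in> G" for b b'
    proof -
      have "c b \<noteq> c b'" using inj_onD[OF c, of b b'] that FG by blast
      then show ?thesis by blast
    qed
    then obtain m where m: "\<And>b b'. \<lbrakk>b \<in> F; b' \<in> G\<rbrakk> \<Longrightarrow> (m b b' \<in> c b) \<noteq> (m b b' \<in> c b')"
      by metis
    \<comment> \<open>\<open>n\<close> exceeds every chosen distinguishing element, so below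
      \<open>n\<close> the sets of \<open>F\<close> still differ from those of \<open>G\<close>. The
      family \<open>A\<close> of traces of \<open>F\<close> then accepts exactly the right
      labels.\<close>
    have "finite ((\<lambda>(b, b'). m b b') ` (F \<times> G))" using FG by simp
    then obtain n where n: "\<And>b b'. \<lbrakk>b \<in> F; b' \<in> G\<rbrakk> \<Longrightarrow> m b b' < n"
      unfolding finite_nat_set_iff_bounded by auto
    define A where "A = (\<lambda>b. c b \<inter> {..<n}) ` F"
    have nA: "(n, A) \<in> \<Omega>" by (auto simp: \<Omega>_def A_def)
    then obtain w where w: "from_nat_into \<Omega> w = (n, A)"
      using from_nat_into_surj[OF cnt] by blast
    have "w \<in> S b" if "b \<in> F" for b using that w by (simp add: S_def A_def)
    moreover have "w \<notin> S b'" if b': "b' \<in> G" for b'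
    proof -
      have "c b' \<inter> {..<n} \<noteq> c b \<inter> {..<n}" if b: "b \<in> F" for b
        using m[OF b b'] n[OF b b'] by blast
      then show ?thesis using w by (auto simp: S_def A_def)
    qed
    ultimately show ?thesis by blast
  qed
  then show ?thesis by blast
qed

lemma uncountable_nat_sets: "uncountable (UNIV :: nat set set)"
proof
  assume "countable (UNIV :: nat set set)"
  then have "range (from_nat_into (UNIV :: nat set set)) = Pow UNIV"
    by (simp add: range_from_nat_into)
  then show False using Cantors_theorem[of "UNIV :: nat set"] by blast
qed

text \<open>The finite intersection property with a distinguished set \<open>C\<close>, the region
  to which the point being sought is confined, kept apart from the indexed conditions
  \<open>G i\<close>.\<close>

lemma compact_space_fip_indexed:
  assumes B: "compact_space B" and C: "closedin B C" and G: "\<And>i. i \<in> I \<Longrightarrow> closedin B (G i)"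
    and fip: "\<And>F. \<lbrakk>finite F; F \<subseteq> I\<rbrakk> \<Longrightarrow> \<exists>p\<in>C. \<forall>i\<in>F. p \<in> G i"
  shows "\<exists>p\<in>C. \<forall>i\<in>I. p \<in> G i"
proof -
  have "(\<forall>D\<in>insert C (G ` I). closedin B D) \<and> (\<forall>\<F>. finite \<F> \<and> \<F> \<subseteq> insert C (G ` I) \<longrightarrow> \<Inter>\<F> \<noteq> {})"
  proof (intro conjI allI impI)
    fix \<F> assume \<F>: "finite \<F> \<and> \<F> \<subseteq> insert C (G ` I)"
    then have "finite (\<F> - {C})" "\<F> - {C} \<subseteq> G ` I" by auto
    then obtain F where F: "finite F" "F \<subseteq> I" "\<F> - {C} = G ` F" by (metis finite_subset_image)
    obtain p where p: "p \<in> C" "\<forall>i\<in>F. p \<in> G i" using fip[OF F(1,2)] by blast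
    have "\<F> \<subseteq> insert C (G ` F)" using F(3) by blast
    then have "p \<in> \<Inter>\<F>" using p by blast
    then show "\<Inter>\<F> \<noteq> {}" by blast
  qed (use C G in auto)
  then have "\<Inter>(insert C (G ` I)) \<noteq> {}"
    using B[unfolded compact_space_fip, rule_format, of "insert C (G ` I)"] by blast
  then show ?thesis by auto
qed

definition lambda_set :: "'a topology \<Rightarrow> (('a \<Rightarrow> real) \<Rightarrow> real) set" where
  "lambda_set X = \<Union>{clopen_ext X S | S. clopen_Lindelof X S}"

lemma clopen_ext_subset_lambda_set: "clopen_Lindelof X S \<Longrightarrow> clopen_ext X S \<subseteq> lambda_set X"
  by (auto simp: lambda_set_def)

lemma openin_lambda_set: "openin (beta X) (lambda_set X)"
  unfolding lambda_set_def
  by (rule openin_Union) (auto simp: clopen_Lindelof_def openin_clopen_ext)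

lemma clopen_ext_disjoint:
  assumes "openin X S" "closedin X S" "openin X T" "closedin X T" "S \<inter> T = {}"
  shows "clopen_ext X S \<inter> clopen_ext X T = {}"
  using clopen_ext_Int[OF assms(1-4)] beta_closure_of_clopen[of X "{}"] assms(5) by simp

section \<open>Partitions into open Lindelof pieces, and the failure of normality\<close>

locale clopen_partition =
  fixes X :: "'a topology" and \<B> :: "'a set set"
  assumes Union_pieces: "\<Union>\<B> = topspace X" and disjoint_pieces: "disjoint \<B>"
    and nonempty_pieces: "{} \<notin> \<B>" and openin_piece: "\<And>B. B \<in> \<B> \<Longrightarrow> openin X B"
    and Lindelof_piece: "\<And>B. B \<in> \<B> \<Longrightarrow> Lindelof_space (subtopology X B)"
begin

lemma piece_unique: "\<lbrakk>B \<in> \<B>; B' \<in> \<B>; x \<in> B; x \<in> B'\<rbrakk> \<Longrightarrow> B = B'"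
  using disjoint_pieces unfolding disjoint_def by blast

lemma clopen_Union:
  assumes "\<J> \<subseteq> \<B>"
  shows "openin X (\<Union>\<J>)" "closedin X (\<Union>\<J>)"
proof -
  show "openin X (\<Union>\<J>)" using assms openin_piece by (intro openin_Union) auto
  have "topspace X - \<Union>\<J> = \<Union>(\<B> - \<J>)"
    using piece_unique assms unfolding Union_pieces[symmetric] by blast
  moreover have "openin X (\<Union>(\<B> - \<J>))" using openin_piece by (intro openin_Union) auto
  moreover have "\<Union>\<J> \<subseteq> topspace X" using assms Union_pieces by blast
  ultimately show "closedin X (\<Union>\<J>)" by (simp add: closedin_def)
qed

lemma clopen_Lindelof_Union:
  assumes "\<J> \<subseteq> \<B>" "countable \<J>"
  shows "clopen_Lindelof X (\<Union>\<J>)"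
  using assms clopen_Union[OF assms(1)] Lindelof_space_Union[of \<J> X] Lindelof_piece
  unfolding clopen_Lindelof_def by blast

text \<open>The pieces are disjoint, so a countable subfamily covering \<open>L\<close> must contain
  every piece that meets \<open>L\<close>.\<close>

lemma Lindelof_meets_countably_many:
  assumes "L \<subseteq> topspace X" "Lindelof_space (subtopology X L)"
  shows "countable {B \<in> \<B>. B \<inter> L \<noteq> {}}"
proof -
  have "\<forall>U\<in>\<B>. openin X U" "L \<subseteq> \<Union>\<B>" using openin_piece Union_pieces assms(1) by auto
  then obtain \<V> where \<V>: "countable \<V>" "\<V> \<subseteq> \<B>" "L \<subseteq> \<Union>\<V>"
    using assms(2) unfolding Lindelof_space_subtopology_subset[OF assms(1)] by meson
  have "{B \<in> \<B>. B \<inter> L \<noteq> {}} \<subseteq> \<V>"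
  proof
    fix B assume "B \<in> {B \<in> \<B>. B \<inter> L \<noteq> {}}"
    then obtain x where B: "B \<in> \<B>" "x \<in> B" "x \<in> L" by blast
    then obtain V where V: "V \<in> \<V>" "x \<in> V" using \<V>(3) by blast
    then have "B = V" using piece_unique[of B V x] B \<V>(2) by blast
    then show "B \<in> \<V>" using V by simp
  qed
  then show ?thesis using \<V>(1) countable_subset by blast
qed

lemma Lindelof_subset_clopen_Lindelof:
  assumes "L \<subseteq> topspace X" "Lindelof_space (subtopology X L)"
  shows "\<exists>S. clopen_Lindelof X S \<and> L \<subseteq> S"
proof (intro exI conjI)
  show "clopen_Lindelof X (\<Union>{B \<in> \<B>. B \<inter> L \<noteq> {}})"
    by (rule clopen_Lindelof_Union) (use Lindelof_meets_countably_many[OF assms] in auto)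
  show "L \<subseteq> \<Union>{B \<in> \<B>. B \<inter> L \<noteq> {}}"
    using assms(1) unfolding Union_pieces[symmetric] by blast
qed

text \<open>Index uncountably many pieces injectively as \<open>j (a, w)\<close> with \<open>a\<close> a finite subset of an
  uncountable \<open>I\<close> and \<open>w\<close> a natural number, and let \<open>S\<close> be an independent family of sets of
  naturals indexed by \<open>I\<close>. The closed sets that cannot be separated are the points at which all
  \<open>w \<in> S b\<close> hold, and the points at which all \<open>b \<in> a \<longleftrightarrow> w \<in> S b\<close> hold: an open
  neighbourhood of the former contains, for each \<open>a\<close>, all pieces with \<open>w\<close> in finitely many
  \<open>S b\<close>, and along an increasing sequence of sets \<open>a\<close> that absorbs these finitely many \<open>b\<close>
  such pieces accumulate at a point of the latter.\<close>

lemma lambda_not_normal: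
  assumes unc: "uncountable \<B>"
  shows "\<not> normal_space (subtopology (beta X) (lambda_set X))"
proof
  assume normal: "normal_space (subtopology (beta X) (lambda_set X))"
  \<comment> \<open>Labels are restricted to at most continuum many: either the pieces themselves
    inject into \<open>nat set\<close>, or a copy of \<open>nat set\<close> is found among them.
    Both choices are uncountable.\<close>
  obtain I and c :: "'a set \<Rightarrow> nat set" where I: "I \<subseteq> \<B>" "uncountable I" and c: "inj_on c I"
  proof (cases "|\<B>| \<le>o |UNIV :: nat set set|")
    case True
    then show ?thesis using that[of \<B>] unc unfolding card_of_ordLeq[symmetric] by blast
  next
    case False
    then have "|UNIV :: nat set set| \<le>o |\<B>|"
      using ordLeq_total[OF card_of_Well_order card_of_Well_order] by blast
    then obtain f :: "nat set \<Rightarrow> 'a set" where f: "inj f" "range f \<subseteq> \<B>" unfolding card_of_ordLeq[symmetric] by blast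
    then have "uncountable (range f)"
      using uncountable_nat_sets by (simp add: countable_image_inj_eq)
    then show ?thesis using that[of "range f" "inv f"] f by (simp add: inj_on_inv_into)
  qed
  have infI: "infinite I" using I(2) countable_finite by blast
  define D where "D = {a. a \<subseteq> I \<and> finite a}"
  \<comment> \<open>An infinite set has as many finite subsets as elements, and a countable factor
    does not increase its size; so \<open>I\<close> has room for a separate piece
    \<open>j (a, w)\<close> for every pair.\<close>
  have "|D \<times> (UNIV :: nat set)| \<le>o |I|"
  proof (rule card_of_Times_ordLeq_infinite_Field)
    show "infinite (Field |I| )" using infI by (simp add: Field_card_of)
    show "|D| \<le>o |I|" unfolding D_def by (rule card_of_finite_subsets[OF infI])
    show "|UNIV :: nat set| \<le>o |I|" using infI infinite_iff_card_of_nat by blast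
  qed (simp add: card_of_card_order_on Field_card_of)
  then obtain j where j: "inj_on j (D \<times> (UNIV :: nat set))" "j ` (D \<times> UNIV) \<subseteq> I"
    unfolding card_of_ordLeq[symmetric] by blast
  have jB: "j (a, w) \<in> \<B>" if "a \<in> D" for a w using j(2) I(1) that by blast
  obtain S :: "'a set \<Rightarrow> nat set" where
      "\<forall>F G. finite F \<and> finite G \<and> F \<subseteq> I \<and> G \<subseteq> I \<and> F \<inter> G = {}
        \<longrightarrow> (\<exists>w. (\<forall>b\<in>F. w \<in> S b) \<and> (\<forall>b\<in>G. w \<notin> S b))"
    using independent_family[OF c] by (elim exE)
  then have S: "\<exists>w. (\<forall>b\<in>F. w \<in> S b) \<and> (\<forall>b\<in>G. w \<notin> S b)"
    if "finite F" "finite G" "F \<subseteq> I" "G \<subseteq> I" "F \<inter> G = {}" for F G using that by simp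
  define x where "x a w = (SOME x. x \<in> j (a, w))" for a w
  have x: "x a w \<in> j (a, w)" if "a \<in> D" for a w
    using jB[OF that, of w] nonempty_pieces unfolding x_def some_in_eq by metis
  have xX: "x a w \<in> topspace X" if "a \<in> D" for a w
    using x[OF that] jB[OF that] Union_pieces by blast
  \<comment> \<open>Translates a condition \<open>T\<close> on pairs into a clopen set: membership
    in \<open>clopen_ext X (U T)\<close> reads as \<open>T\<close> holding at that point of
    \<open>beta X\<close>. Countable \<open>T\<close> give subsets of
    \<open>lambda_set X\<close>.\<close>
  define U where "U T = \<Union>(j ` (T \<inter> D \<times> UNIV))" for T
  have Ucl: "openin X (U T)" "closedin X (U T)" for T
    unfolding U_def using jB by (auto intro!: clopen_Union)
  have UL: "clopen_Lindelof X (U T)" if "countable T" for T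
    unfolding U_def using jB that by (intro clopen_Lindelof_Union) auto
  have Umono: "clopen_ext X (U T) \<subseteq> clopen_ext X (U T')" if "T \<inter> D \<times> UNIV \<subseteq> T'" for T T'
    using that by (intro clopen_ext_mono Ucl) (auto simp: U_def)
  have Uint: "U T \<inter> U T' = U (T \<inter> T')" for T T'
  proof
    show "U T \<inter> U T' \<subseteq> U (T \<inter> T')"
    proof
      fix y assume "y \<in> U T \<inter> U T'"
      then obtain t t' where t: "t \<in> T \<inter> D \<times> UNIV" "t' \<in> T' \<inter> D \<times> UNIV" "y \<in> j t" "y \<in> j t'"
        unfolding U_def by blast
      then have "j t = j t'" using piece_unique[of "j t" "j t'" y] j(2) I(1) by blast
      then have "t = t'" using inj_onD[OF j(1)] t by blast
      then show "y \<in> U (T \<inter> T')" using t unfolding U_def by blast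
    qed
  qed (auto simp: U_def)
  have exU: "beta_embed X (x a w) \<in> clopen_ext X (U T)" if "a \<in> D" "(a, w) \<in> T" for a w T
  proof -
    have "x a w \<in> U T" using that x[of a w] by (auto simp: U_def)
    then show ?thesis using beta_embed_in_clopen_ext[OF Ucl xX] that(1) by blast
  qed
  define Q where "Q b = clopen_ext X (U {(a, w). w \<in> S b})" for b
  define G where "G b = clopen_ext X (U {(a, w). b \<in> a \<longleftrightarrow> w \<in> S b})" for b
  define W where "W = clopen_ext X (U UNIV)"
  have cl: "closedin (beta X) (Q b)" "closedin (beta X) (G b)" "closedin (beta X) W" for b
    by (auto simp: Q_def G_def W_def closedin_clopen_ext Ucl)
  define K where "K = lambda_set X \<inter> (W \<inter> (\<Inter>b\<in>I. Q b))"
  define H where "H = lambda_set X \<inter> (W \<inter> (\<Inter>b\<in>I. G b))"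
  have "I \<noteq> {}" using infI by auto
  have KH: "closedin (subtopology (beta X) (lambda_set X)) K" "closedin (subtopology (beta X) (lambda_set X)) H"
    unfolding K_def H_def using cl \<open>I \<noteq> {}\<close>
    by (auto intro!: closedin_subtopology_Int_closed closedin_Int closedin_INT)
  have "disjnt K H"
    unfolding disjnt_def
  proof (rule ccontr)
    assume "K \<inter> H \<noteq> {}"
    then obtain p where p: "p \<in> lambda_set X" "\<And>b. b \<in> I \<Longrightarrow> p \<in> Q b \<and> p \<in> G b"
      by (auto simp: K_def H_def)
    obtain L where L: "clopen_Lindelof X L" "p \<in> clopen_ext X L" using p(1) by (auto simp: lambda_set_def)
    then have Lcl: "openin X L" "closedin X L" "Lindelof_space (subtopology X L)" by (auto simp: clopen_Lindelof_def)
    \<comment> \<open>\<open>L\<close> meets pieces for only countably many pairs, and the finite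
      sets \<open>a\<close> in them have a countable union, so some \<open>b\<close> in
      \<open>I\<close> avoids them all. At \<open>p\<close> the conditions
      \<open>w \<in> S b\<close> and \<open>b \<in> a \<longleftrightarrow> w \<in> S b\<close>
      force \<open>b \<in> a\<close>, which no piece meeting \<open>L\<close> satisfies.\<close>
    define M where "M = {t \<in> D \<times> UNIV. j t \<inter> L \<noteq> {}}"
    have "j ` M \<subseteq> {B \<in> \<B>. B \<inter> L \<noteq> {}}" using j(2) I(1) by (auto simp: M_def)
    then have "countable (j ` M)"
      using Lindelof_meets_countably_many[OF openin_subset[OF Lcl(1)] Lcl(3)] countable_subset by blast
    then have "countable M"
      by (rule countable_image_inj_on) (rule inj_on_subset[OF j(1)], auto simp: M_def)
    then have "countable (\<Union>t\<in>M. fst t)"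
      by (rule countable_UN) (auto simp: M_def D_def intro: countable_finite)
    then have "\<not> I \<subseteq> (\<Union>t\<in>M. fst t)" using I(2) countable_subset by metis
    then obtain b where b: "b \<in> I" "b \<notin> (\<Union>t\<in>M. fst t)" by blast
    have "p \<in> clopen_ext X (U ({(a, w). w \<in> S b} \<inter> {(a, w). b \<in> a \<longleftrightarrow> w \<in> S b}))"
      using p(2)[OF b(1)] unfolding Q_def G_def Uint[symmetric] clopen_ext_Int[OF Ucl Ucl] by blast
    then have "p \<in> clopen_ext X (U {(a, w). b \<in> a})" by (rule subsetD[OF Umono, rotated]) auto
    moreover have "U {(a, w). b \<in> a} \<inter> L = {}" using b(2) by (force simp: U_def M_def)
    ultimately show False using clopen_ext_disjoint[OF Ucl Lcl(1,2)] L(2) by blast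
  qed
  then obtain VK VH where V: "openin (beta X) VK" "openin (beta X) VH" "K \<subseteq> VK" "H \<subseteq> VH" "disjnt VK VH"
    using normal[unfolded normal_space_def, rule_format, of K H] KH
    unfolding openin_open_subtopology[OF openin_lambda_set] by metis
  \<comment> \<open>Otherwise compactness yields a point over the pieces with first index
    \<open>a\<close> that lies outside \<open>VK\<close> and in every \<open>Q b\<close>. Only
    countably many pieces are involved, so the point belongs to \<open>Y\<close>, hence to
    \<open>K\<close>, a contradiction.\<close>
  have "\<exists>F. finite F \<and> F \<subseteq> I \<and> (\<forall>w. (\<forall>b\<in>F. w \<in> S b) \<longrightarrow> beta_embed X (x a w) \<in> VK)" if a: "a \<in> D" for a
  proof (rule ccontr)
    assume neg: "\<not> ?thesis"
    have "\<exists>p\<in>clopen_ext X (U ({a} \<times> UNIV)) - VK. \<forall>b\<in>I. p \<in> Q b"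
    proof (rule compact_space_fip_indexed[OF compact_beta _ cl(1)])
      show "closedin (beta X) (clopen_ext X (U ({a} \<times> UNIV)) - VK)"
        using V(1) by (intro closedin_diff closedin_clopen_ext Ucl)
      fix F assume F: "finite F" "F \<subseteq> I"
      then obtain w where w: "\<forall>b\<in>F. w \<in> S b" "beta_embed X (x a w) \<notin> VK" using neg by blast
      then show "\<exists>p\<in>clopen_ext X (U ({a} \<times> UNIV)) - VK. \<forall>b\<in>F. p \<in> Q b"
        using a by (intro bexI[of _ "beta_embed X (x a w)"]) (auto simp: Q_def exU)
    qed
    then obtain p where p: "p \<in> clopen_ext X (U ({a} \<times> UNIV))" "p \<notin> VK" "\<forall>b\<in>I. p \<in> Q b" by blast
    have "p \<in> lambda_set X" using clopen_ext_subset_lambda_set[OF UL, of "{a} \<times> UNIV"] p(1) by auto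
    moreover have "p \<in> W" unfolding W_def using subsetD[OF Umono p(1), of UNIV] by blast
    ultimately show False using p V(3) by (auto simp: K_def)
  qed
  then obtain \<Phi> where \<Phi>: "\<And>a. a \<in> D \<Longrightarrow> finite (\<Phi> a)" "\<And>a. a \<in> D \<Longrightarrow> \<Phi> a \<subseteq> I"
      "\<And>a w. \<lbrakk>a \<in> D; \<forall>b\<in>\<Phi> a. w \<in> S b\<rbrakk> \<Longrightarrow> beta_embed X (x a w) \<in> VK" by metis
  define \<alpha> where "\<alpha> = rec_nat {} (\<lambda>_ a. a \<union> \<Phi> a)"
  have \<alpha>: "\<alpha> 0 = {}" "\<alpha> (Suc k) = \<alpha> k \<union> \<Phi> (\<alpha> k)" for k by (auto simp: \<alpha>_def)
  have \<alpha>D: "\<alpha> k \<in> D" for k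
  proof (induction k)
    case (Suc k)
    then show ?case using \<Phi>(1,2)[OF Suc] by (auto simp: \<alpha> D_def)
  qed (simp add: \<alpha> D_def)
  have \<alpha>mono: "\<alpha> k \<subseteq> \<alpha> l" if "k \<le> l" for k l
    using that by (rule lift_Suc_mono_le[rotated]) (auto simp: \<alpha>)
  define E where "E = {beta_embed X (x (\<alpha> k) w) | k w. \<forall>b\<in>\<Phi> (\<alpha> k). w \<in> S b}"
  have EV: "E \<subseteq> VK" using \<Phi>(3)[OF \<alpha>D] by (auto simp: E_def)
  have ET: "E \<subseteq> clopen_ext X (U (range \<alpha> \<times> UNIV))" using exU[OF \<alpha>D] by (auto simp: E_def)
  have "\<exists>p\<in>beta X closure_of E. \<forall>b\<in>I. p \<in> G b"
  proof (rule compact_space_fip_indexed[OF compact_beta closedin_closure_of cl(2)])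
    fix F assume F: "finite F" "F \<subseteq> I"
    have "\<exists>k. F \<inter> (\<Union>l. \<alpha> l) \<subseteq> \<alpha> k"
      using F(1)
    proof (induction F rule: finite_induct)
      case (insert b F)
      then obtain k where k: "F \<inter> (\<Union>l. \<alpha> l) \<subseteq> \<alpha> k" by blast
      show ?case
      proof (cases "b \<in> (\<Union>l. \<alpha> l)")
        case True
        then obtain l where "b \<in> \<alpha> l" by blast
        then show ?thesis
          using k \<alpha>mono[of k "max k l"] \<alpha>mono[of l "max k l"] by (intro exI[of _ "max k l"]) auto
      qed (use k in auto)
    qed simp
    then obtain k where k: "F \<inter> (\<Union>l. \<alpha> l) \<subseteq> \<alpha> k" by blast
    \<comment> \<open>Membership for \<open>\<Phi> (\<alpha> k)\<close> puts the point in
      \<open>E\<close>; the remaining demands make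
      \<open>b \<in> \<alpha> k \<longleftrightarrow> w \<in> S b\<close> true for all
      \<open>b\<close> in \<open>F\<close>. They are compatible since
      \<open>\<Phi> (\<alpha> k)\<close> is absorbed at stage \<open>k + 1\<close>, while
      \<open>k\<close> was chosen so late that no element of \<open>F\<close> enters after
      it.\<close>
    have "\<exists>w. (\<forall>b\<in>\<Phi> (\<alpha> k) \<union> (F \<inter> \<alpha> k). w \<in> S b) \<and> (\<forall>b\<in>F - \<alpha> k. w \<notin> S b)"
    proof (rule S)
      show "(\<Phi> (\<alpha> k) \<union> F \<inter> \<alpha> k) \<inter> (F - \<alpha> k) = {}" using k \<alpha>(2)[of k] by blast
    qed (use F \<Phi>(1,2)[OF \<alpha>D] in auto)
    then obtain w where w: "\<forall>b\<in>\<Phi> (\<alpha> k) \<union> (F \<inter> \<alpha> k). w \<in> S b" "\<forall>b\<in>F - \<alpha> k. w \<notin> S b" by blast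
    have "beta_embed X (x (\<alpha> k) w) \<in> E" using w(1) by (auto simp: E_def)
    moreover have "E \<subseteq> topspace (beta X)" using ET clopen_ext_subset by blast
    ultimately have "beta_embed X (x (\<alpha> k) w) \<in> beta X closure_of E"
      using closure_of_subset by blast
    moreover have "beta_embed X (x (\<alpha> k) w) \<in> G b" if "b \<in> F" for b
      unfolding G_def using that w by (intro exU \<alpha>D) auto
    ultimately show "\<exists>p\<in>beta X closure_of E. \<forall>b\<in>F. p \<in> G b" by blast
  qed
  then obtain p where p: "p \<in> beta X closure_of E" "\<forall>b\<in>I. p \<in> G b" by blast
  \<comment> \<open>The sequence uses only countably many pieces, so the accumulation point found in
    \<open>beta X\<close> stays in \<open>Y\<close>.\<close>
  have "p \<in> clopen_ext X (U (range \<alpha> \<times> UNIV))"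
    using closure_of_minimal[OF ET closedin_clopen_ext[OF Ucl]] p(1) by blast
  moreover from this have "p \<in> lambda_set X"
    using clopen_ext_subset_lambda_set[OF UL, of "range \<alpha> \<times> UNIV"] by auto
  moreover from calculation have "p \<in> W"
    unfolding W_def using subsetD[OF Umono, of "range \<alpha> \<times> UNIV" UNIV] by blast
  ultimately have "p \<in> VH" using p(2) V(4) by (auto simp: H_def)
  then have "VH \<inter> E \<noteq> {}"
    using p(1) V(2) by (metis in_closure_of disjoint_iff)
  then show False using EV V(5) by (auto simp: disjnt_def)
qed

end

section \<open>Bounded continuous functions\<close>

lemma C_b_iff:
  fixes f :: "'a \<Rightarrow> 'k::real_normed_field"
  shows "f \<in> C_b X \<longleftrightarrow> continuous_map X euclidean f \<and> (\<exists>M. \<forall>x\<in>topspace X. norm (f x) \<le> M)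
    \<and> (\<forall>x. x \<notin> topspace X \<longrightarrow> f x = 0)"
  by (auto simp: C_b_def bounded_iff)

lemma C_b_closed_under:
  fixes f g :: "'a \<Rightarrow> 'k::real_normed_field"
  assumes f: "f \<in> C_b X" and g: "g \<in> C_b X"
  shows "(\<lambda>x. f x + g x) \<in> C_b X" "(\<lambda>x. c * f x) \<in> C_b X" "(\<lambda>x. f x * g x) \<in> C_b X"
proof -
  obtain M N where MN: "\<forall>x\<in>topspace X. norm (f x) \<le> M" "\<forall>x\<in>topspace X. norm (g x) \<le> N"
    using f g unfolding C_b_iff by blast
  have "\<forall>x\<in>topspace X. norm (f x + g x) \<le> M + N" using MN by (meson add_mono norm_triangle_le)
  then show "(\<lambda>x. f x + g x) \<in> C_b X"
    using f g by (auto simp: C_b_iff intro!: continuous_map_add_normed)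
  have "\<forall>x\<in>topspace X. norm (c * f x) \<le> norm c * M" using MN by (simp add: norm_mult mult_left_mono)
  then show "(\<lambda>x. c * f x) \<in> C_b X"
    using f by (auto simp: C_b_iff intro!: continuous_map_mult_normed)
  have "norm (f x * g x) \<le> M * N" if "x \<in> topspace X" for x
    using MN that order_trans[OF norm_ge_zero, of "f x" M] unfolding norm_mult by (intro mult_mono) auto
  then show "(\<lambda>x. f x * g x) \<in> C_b X"
    using f g by (auto simp: C_b_iff intro!: continuous_map_mult_normed)
qed

lemma norm_le_supnorm:
  assumes "f \<in> C_b X" "x \<in> topspace X"
  shows "norm (f x) \<le> supnorm X f"
  unfolding supnorm_def
  by (rule cSUP_upper[OF assms(2)]) (use assms(1) in \<open>auto simp: C_b_iff bdd_above_def\<close>)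

lemma supnorm_le:
  assumes "topspace X \<noteq> {}" "\<And>x. x \<in> topspace X \<Longrightarrow> norm (f x) \<le> c"
  shows "supnorm X f \<le> c"
  unfolding supnorm_def using assms by (rule cSUP_least)

text \<open>The pointwise limit is part of the conclusion because it transfers vanishing off a
  common set from the sequence to \<open>f\<close>.\<close>

lemma C_b_complete:
  fixes s :: "nat \<Rightarrow> 'a \<Rightarrow> 'k::{real_normed_field, euclidean_space}"
  assumes ne: "topspace X \<noteq> {}" and s: "\<And>n. s n \<in> C_b X"
    and cauchy: "\<And>e. e > 0 \<Longrightarrow> \<exists>N. \<forall>m\<ge>N. \<forall>n\<ge>N. supnorm X (\<lambda>x. s m x - s n x) < e"
  obtains f where "f \<in> C_b X" "(\<lambda>n. supnorm X (\<lambda>x. s n x - f x)) \<longlonglongrightarrow> 0"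
    "\<And>x. (\<lambda>n. s n x) \<longlonglongrightarrow> f x"
proof -
  have diff: "(\<lambda>x. s m x - s n x) \<in> C_b X" for m n
    using C_b_closed_under(1)[OF s C_b_closed_under(2)[OF s s], of m "-1" n] by simp
  have unif: "\<exists>N. \<forall>m\<ge>N. \<forall>n\<ge>N. \<forall>x. norm (s m x - s n x) < e" if e: "e > 0" for e
  proof -
    obtain N where N: "\<forall>m\<ge>N. \<forall>n\<ge>N. supnorm X (\<lambda>x. s m x - s n x) < e"
      using cauchy[OF e] by blast
    have "norm (s m x - s n x) < e" if "m \<ge> N" "n \<ge> N" for m n x
    proof (cases "x \<in> topspace X")
      case True
      have "norm (s m x - s n x) \<le> supnorm X (\<lambda>x. s m x - s n x)"
        using norm_le_supnorm[OF diff True] .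
      then show ?thesis using N that by force
    next
      case False
      then show ?thesis using s \<open>e > 0\<close> by (simp add: C_b_iff)
    qed
    then show ?thesis by blast
  qed
  have "Cauchy (\<lambda>n. s n x)" for x
    unfolding Cauchy_iff using unif by meson
  then have "convergent (\<lambda>n. s n x)" for x by (simp add: Cauchy_convergent)
  then obtain f where f: "\<And>x. (\<lambda>n. s n x) \<longlonglongrightarrow> f x"
    unfolding convergent_def by metis
  have uf: "\<exists>N. \<forall>m\<ge>N. \<forall>x. norm (s m x - f x) \<le> e" if e: "e > 0" for e
  proof -
    obtain N where N: "\<And>m n x. \<lbrakk>m \<ge> N; n \<ge> N\<rbrakk> \<Longrightarrow> norm (s m x - s n x) < e" using unif[OF e] by blast
    have "norm (s m x - f x) \<le> e" if m: "m \<ge> N" for m x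
    proof (rule tendsto_upperbound)
      show "(\<lambda>n. norm (s m x - s n x)) \<longlonglongrightarrow> norm (s m x - f x)"
        by (intro tendsto_intros f)
      show "\<forall>\<^sub>F n in sequentially. norm (s m x - s n x) \<le> e"
        unfolding eventually_sequentially using N[OF m] by (meson less_imp_le)
    qed simp
    then show ?thesis by blast
  qed
  have cont: "continuous_map X euclidean f"
  proof -
    have "continuous_map X Met_TC.mtopology f"
    proof (rule Met_TC.continuous_map_uniform_limit)
      show "\<forall>\<^sub>F n in sequentially. continuous_map X Met_TC.mtopology (s n)"
        using s by (simp add: C_b_iff)
      fix e :: real assume "e > 0"
      then obtain N where N: "\<forall>m\<ge>N. \<forall>x. norm (s m x - f x) \<le> e / 2" using uf[of "e / 2"] by auto
      have "\<forall>x\<in>topspace X. f x \<in> UNIV \<and> dist (s n x) (f x) < e" if "n \<ge> N" for n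
      proof
        fix x
        have "norm (s n x - f x) \<le> e / 2" using N that by blast
        then show "f x \<in> UNIV \<and> dist (s n x) (f x) < e" using \<open>e > 0\<close> by (simp add: dist_norm)
      qed
      then show "\<forall>\<^sub>F n in sequentially. \<forall>x\<in>topspace X. f x \<in> UNIV \<and> dist (s n x) (f x) < e"
        unfolding eventually_sequentially by blast
    qed simp
    then show ?thesis by simp
  qed
  have f0: "f x = 0" if "x \<notin> topspace X" for x
    using f[of x] s that LIMSEQ_unique[of "\<lambda>n. s n x" "f x" 0] by (simp add: C_b_iff)
  obtain N where N: "\<forall>m\<ge>N. \<forall>x. norm (s m x - f x) \<le> 1" using uf[of 1] by auto
  obtain M where M: "\<forall>x\<in>topspace X. norm (s N x) \<le> M" using s[of N] by (auto simp: C_b_iff)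
  have "norm (f x) \<le> M + 1" if "x \<in> topspace X" for x
  proof -
    have "norm (s N x) \<le> M" "norm (s N x - f x) \<le> 1" using M N that by auto
    then show ?thesis using norm_triangle_ineq4[of "s N x" "s N x - f x"] by simp
  qed
  then have fC: "f \<in> C_b X" using cont f0 by (auto simp: C_b_iff)
  have "(\<lambda>n. supnorm X (\<lambda>x. s n x - f x)) \<longlonglongrightarrow> 0"
  proof (rule LIMSEQ_I)
    fix e :: real assume e: "e > 0"
    then obtain N where N: "\<forall>m\<ge>N. \<forall>x. norm (s m x - f x) \<le> e / 2" using uf[of "e / 2"] by auto
    have "norm (supnorm X (\<lambda>x. s n x - f x) - 0) < e" if n: "n \<ge> N" for n
    proof -
      have "supnorm X (\<lambda>x. s n x - f x) \<le> e / 2" using N n by (intro supnorm_le ne) auto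
      moreover have "supnorm X (\<lambda>x. s n x - f x) \<ge> 0"
      proof -
        obtain x where x: "x \<in> topspace X" using ne by blast
        have "(\<lambda>x. s n x - f x) \<in> C_b X"
          using C_b_closed_under(1)[OF s[of n] C_b_closed_under(2)[OF fC fC, of "-1"]] by simp
        from norm_le_supnorm[OF this x] show ?thesis by (rule order_trans[OF norm_ge_zero])
      qed
      ultimately show ?thesis using e by simp
    qed
    then show "\<exists>N. \<forall>n\<ge>N. norm (supnorm X (\<lambda>x. s n x - f x) - 0) < e" by blast
  qed
  then show ?thesis using that fC f by blast
qed

text \<open>The map with an explicit formula goes from \<open>B\<close> to \<open>A\<close>: it is
  restriction along an embedding, so it respects the operations for all functions, as
  \<open>hom\<close> demands. The required isomorphism is its inverse.\<close>

lemma isometrically_isomorphicI_inverse: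
  fixes \<psi> :: "('b \<Rightarrow> 'k::real_normed_field) \<Rightarrow> ('a \<Rightarrow> 'k)"
  assumes bij: "bij_betw \<psi> B A"
    and cl: "\<And>f g. \<lbrakk>f \<in> B; g \<in> B\<rbrakk> \<Longrightarrow> (\<lambda>y. f y + g y) \<in> B" "\<And>c f. f \<in> B \<Longrightarrow> (\<lambda>y. c * f y) \<in> B"
      "\<And>f g. \<lbrakk>f \<in> B; g \<in> B\<rbrakk> \<Longrightarrow> (\<lambda>y. f y * g y) \<in> B"
    and hom: "\<And>f g. \<psi> (\<lambda>y. f y + g y) = (\<lambda>x. \<psi> f x + \<psi> g x)" "\<And>c f. \<psi> (\<lambda>y. c * f y) = (\<lambda>x. c * \<psi> f x)"
      "\<And>f g. \<psi> (\<lambda>y. f y * g y) = (\<lambda>x. \<psi> f x * \<psi> g x)"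
    and iso: "\<And>g. g \<in> B \<Longrightarrow> supnorm X (\<psi> g) = supnorm Y g"
  shows "isometrically_isomorphic X A Y B"
  unfolding isometrically_isomorphic_def
proof (intro exI conjI ballI allI)
  let ?\<phi> = "inv_into B \<psi>"
  show "bij_betw ?\<phi> A B" by (rule bij_betw_inv_into[OF bij])
  have A: "?\<phi> f \<in> B" "\<psi> (?\<phi> f) = f" if "f \<in> A" for f
    using bij that unfolding bij_betw_def by (simp_all add: f_inv_into_f inv_into_into)
  have inv: "?\<phi> (\<psi> g) = g" if "g \<in> B" for g
    using bij that unfolding bij_betw_def by simp
  fix f assume f: "f \<in> A"
  show "supnorm Y (?\<phi> f) = supnorm X f" using iso[OF A(1)[OF f]] A(2)[OF f] by simp
  show "?\<phi> (\<lambda>x. c * f x) = (\<lambda>y. c * ?\<phi> f y)" for c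
    using inv[OF cl(2)[OF A(1)[OF f], of c]] unfolding hom(2) A(2)[OF f] .
  fix g assume g: "g \<in> A"
  show "?\<phi> (\<lambda>x. f x + g x) = (\<lambda>y. ?\<phi> f y + ?\<phi> g y)"
    using inv[OF cl(1)[OF A(1)[OF f] A(1)[OF g]]] unfolding hom(1) A(2)[OF f] A(2)[OF g] .
  show "?\<phi> (\<lambda>x. f x * g x) = (\<lambda>y. ?\<phi> f y * ?\<phi> g y)"
    using inv[OF cl(3)[OF A(1)[OF f] A(1)[OF g]]] unfolding hom(3) A(2)[OF f] A(2)[OF g] .
qed

lemma isometrically_isomorphic_C_c_unique:
  fixes A :: "('a \<Rightarrow> 'k::real_normed_field) set" and Y :: "'b topology" and Z :: "'c topology"
  assumes A: "subalgebra_C_b X A" and Y: "locally_compact Y" and Z: "locally_compact Z"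
    and iY: "isometrically_isomorphic X A Y (C_c Y)" and iZ: "isometrically_isomorphic X A Z (C_c Z)"
  shows "Z homeomorphic_space Y"
proof -
  obtain \<phi> where \<phi>: "bij_betw \<phi> A (C_c Y)"
      "\<forall>f\<in>A. \<forall>g\<in>A. \<phi> (\<lambda>x. f x + g x) = (\<lambda>y. \<phi> f y + \<phi> g y)"
      "\<forall>c. \<forall>f\<in>A. \<phi> (\<lambda>x. c * f x) = (\<lambda>y. c * \<phi> f y)"
      "\<forall>f\<in>A. \<forall>g\<in>A. \<phi> (\<lambda>x. f x * g x) = (\<lambda>y. \<phi> f y * \<phi> g y)"
    using iY unfolding isometrically_isomorphic_def by (elim exE conjE)
  obtain \<psi> where \<psi>: "bij_betw \<psi> A (C_c Z)"
      "\<forall>f\<in>A. \<forall>g\<in>A. \<psi> (\<lambda>x. f x + g x) = (\<lambda>y. \<psi> f y + \<psi> g y)"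
      "\<forall>c. \<forall>f\<in>A. \<psi> (\<lambda>x. c * f x) = (\<lambda>y. c * \<psi> f y)"
      "\<forall>f\<in>A. \<forall>g\<in>A. \<psi> (\<lambda>x. f x * g x) = (\<lambda>y. \<psi> f y * \<psi> g y)"
    using iZ unfolding isometrically_isomorphic_def by (elim exE conjE)
  have cl: "(\<lambda>x. f x + g x) \<in> A" "(\<lambda>x. c * f x) \<in> A" "(\<lambda>x. f x * g x) \<in> A"
    if "f \<in> A" "g \<in> A" for c f g using A that by (auto simp: subalgebra_C_b_def)
  define \<iota> where "\<iota> = inv_into A \<phi>"
  have \<iota>: "\<iota> f \<in> A" "\<phi> (\<iota> f) = f" if "f \<in> C_c Y" for f
    using \<phi>(1) that unfolding bij_betw_def \<iota>_def by (simp_all add: f_inv_into_f inv_into_into)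
  have inv: "\<iota> (\<phi> g) = g" if "g \<in> A" for g
    using \<phi>(1) that unfolding bij_betw_def \<iota>_def by simp
  have "Y homeomorphic_space Z"
  proof (rule C_c_isomorphic_imp_homeomorphic[OF Y Z, where T = "\<psi> \<circ> \<iota>"])
    show "bij_betw (\<psi> \<circ> \<iota>) (C_c Y) (C_c Z)"
      unfolding \<iota>_def by (rule bij_betw_trans[OF bij_betw_inv_into[OF \<phi>(1)] \<psi>(1)])
    fix f :: "'b \<Rightarrow> 'k" assume f: "f \<in> C_c Y"
    have "\<iota> (\<lambda>x. c * f x) = (\<lambda>x. c * \<iota> f x)" for c
      using inv[OF cl(2)[OF \<iota>(1)[OF f] \<iota>(1)[OF f], of c]] \<phi>(3) \<iota>[OF f] by simp
    then show "(\<psi> \<circ> \<iota>) (\<lambda>x. c * f x) = (\<lambda>y. c * (\<psi> \<circ> \<iota>) f y)" for c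
      using \<psi>(3) \<iota>(1)[OF f] by simp
    fix g :: "'b \<Rightarrow> 'k" assume g: "g \<in> C_c Y"
    have "\<iota> (\<lambda>x. f x + g x) = (\<lambda>x. \<iota> f x + \<iota> g x)"
      using inv[OF cl(1)[OF \<iota>(1)[OF f] \<iota>(1)[OF g]]] \<phi>(2) \<iota>[OF f] \<iota>[OF g] by simp
    then show "(\<psi> \<circ> \<iota>) (\<lambda>x. f x + g x) = (\<lambda>y. (\<psi> \<circ> \<iota>) f y + (\<psi> \<circ> \<iota>) g y)"
      using \<psi>(2) \<iota>(1)[OF f] \<iota>(1)[OF g] by simp
    have "\<iota> (\<lambda>x. f x * g x) = (\<lambda>x. \<iota> f x * \<iota> g x)"
      using inv[OF cl(3)[OF \<iota>(1)[OF f] \<iota>(1)[OF g]]] \<phi>(4) \<iota>[OF f] \<iota>[OF g] by simp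
    then show "(\<psi> \<circ> \<iota>) (\<lambda>x. f x * g x) = (\<lambda>y. (\<psi> \<circ> \<iota>) f y * (\<psi> \<circ> \<iota>) g y)"
      using \<psi>(4) \<iota>(1)[OF f] \<iota>(1)[OF g] by simp
  qed
  then show ?thesis by (rule homeomorphic_space_sym[THEN iffD1])
qed

lemma C_c_subset_C_0: "(C_c X :: ('a \<Rightarrow> 'k::real_normed_field) set) \<subseteq> C_0 X"
proof
  fix f :: "'a \<Rightarrow> 'k" assume f: "f \<in> C_c X"
  note C = C_cD[OF f]
  have "compactin X {x \<in> topspace X. norm (f x) \<ge> e}" if e: "e > 0" for e
  proof (rule closed_compactin[OF C(3)])
    show "{x \<in> topspace X. norm (f x) \<ge> e} \<subseteq> supp X f"
      using Coz_subset_supp[of X f] e by (auto simp: Coz_def)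
    have "closedin X {x \<in> topspace X. f x \<in> {v. norm v \<ge> e}}"
      by (rule closedin_continuous_map_preimage[OF C(1)])
        (simp add: closed_Collect_le continuous_on_norm_id)
    then show "closedin X {x \<in> topspace X. norm (f x) \<ge> e}" by simp
  qed
  then show "f \<in> C_0 X" using C(4) by (simp add: C_0_def)
qed

text \<open>Turns the compactness conditions in \<open>C_0\<close>, one for each real threshold,
  into a sequence of compact sets to which countable upper bounds apply.\<close>

lemma Coz_eq_Union_norm_ge:
  "Coz X f = (\<Union>n. {x \<in> topspace X. norm (f x) \<ge> inverse (real (Suc n))})"
proof -
  have "\<exists>n. norm (f x) \<ge> inverse (real (Suc n))" if "f x \<noteq> 0" for x
    using reals_Archimedean[of "norm (f x)"] that by (auto intro: less_imp_le)
  then show ?thesis by (fastforce simp: Coz_def)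
qed

section \<open>The space \<open>\<lambda>\<^sub>P X\<close> of a partitioned space\<close>

context clopen_partition
begin

text \<open>A countable union of clopen sets may fail to be closed; it is still Lindelof, so it
  meets countably many pieces, and the union of those pieces is clopen.\<close>

lemma clopen_Lindelof_countable_bound:
  assumes "countable \<S>" "\<And>S. S \<in> \<S> \<Longrightarrow> clopen_Lindelof X S"
  obtains T where "clopen_Lindelof X T" "\<And>S. S \<in> \<S> \<Longrightarrow> S \<subseteq> T" "\<And>S. S \<in> \<S> \<Longrightarrow> clopen_ext X S \<subseteq> clopen_ext X T"
proof -
  have lin: "Lindelof_space (subtopology X (\<Union>\<S>))"
    using assms by (intro Lindelof_space_Union) (auto simp: clopen_Lindelof_def)
  have sub: "\<Union>\<S> \<subseteq> topspace X"
    using assms(2) by (auto simp: clopen_Lindelof_def dest: openin_subset)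
  obtain T where T: "clopen_Lindelof X T" "\<Union>\<S> \<subseteq> T"
    using Lindelof_subset_clopen_Lindelof[OF sub lin] by (elim exE conjE)
  show ?thesis
  proof (rule that[OF T(1)])
    fix S assume S: "S \<in> \<S>"
    show "S \<subseteq> T" using T(2) S by blast
    then show "clopen_ext X S \<subseteq> clopen_ext X T"
      using assms(2)[OF S] T(1) unfolding clopen_Lindelof_def by (intro clopen_ext_mono) auto
  qed
qed

lemma beta_embed_in_lambda_set: "x \<in> topspace X \<Longrightarrow> beta_embed X x \<in> lambda_set X"
proof -
  assume x: "x \<in> topspace X"
  then obtain B where B: "B \<in> \<B>" "x \<in> B" using Union_pieces by blast
  have "clopen_Lindelof X B" using clopen_Lindelof_Union[of "{B}"] B by simp
  then show ?thesis
    using clopen_ext_subset_lambda_set[of X B] beta_embed_in_clopen_ext[of X B x] x B(2)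
    by (auto simp: clopen_Lindelof_def)
qed

abbreviation "\<Lambda> \<equiv> subtopology (beta X) (lambda_set X)"

lemma topspace_lambda: "topspace \<Lambda> = lambda_set X"
  using openin_subset[OF openin_lambda_set, of X] by (simp add: Int_absorb1)

lemma Hausdorff_lambda: "Hausdorff_space \<Lambda>"
  by (intro Hausdorff_space_subtopology Hausdorff_beta)

lemma locally_compact_lambda: "locally_compact \<Lambda>"
  unfolding locally_compact_def
  using Hausdorff_lambda locally_compact_space_open_subset[OF disjI1[OF Hausdorff_beta] _ openin_lambda_set]
    compact_imp_locally_compact_space[OF compact_beta] by blast

lemma compactin_clopen_ext:
  assumes "clopen_Lindelof X S"
  shows "compactin \<Lambda> (clopen_ext X S)"
  using assms clopen_ext_subset_lambda_set[OF assms]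
  by (auto simp: compactin_subtopology clopen_Lindelof_def intro!: closedin_compact_space compact_beta closedin_clopen_ext)

lemma compactin_lambda_subset_clopen_ext:
  assumes "compactin \<Lambda> K"
  obtains S where "clopen_Lindelof X S" "K \<subseteq> clopen_ext X S"
proof -
  have "\<forall>U\<in>clopen_ext X ` Collect (clopen_Lindelof X). openin \<Lambda> U"
    using clopen_ext_subset_lambda_set
    by (auto simp: openin_open_subtopology[OF openin_lambda_set] clopen_Lindelof_def openin_clopen_ext)
  moreover have "K \<subseteq> \<Union>(clopen_ext X ` Collect (clopen_Lindelof X))"
    using compactin_subset_topspace[OF assms] unfolding topspace_lambda
    by (simp add: lambda_set_def image_Collect conj_commute)
  ultimately obtain \<F> where \<F>: "finite \<F>" "\<F> \<subseteq> clopen_ext X ` Collect (clopen_Lindelof X)" "K \<subseteq> \<Union>\<F>"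
    using assms unfolding compactin_def by meson
  then obtain \<S> where \<S>: "finite \<S>" "\<S> \<subseteq> Collect (clopen_Lindelof X)" "\<F> = clopen_ext X ` \<S>"
    by (metis finite_subset_image)
  obtain T where "clopen_Lindelof X T" "\<And>S. S \<in> \<S> \<Longrightarrow> clopen_ext X S \<subseteq> clopen_ext X T"
    using clopen_Lindelof_countable_bound[of \<S>] \<S> countable_finite by (metis mem_Collect_eq subsetD)
  then show ?thesis using that[of T] \<F>(3) \<S>(3) by blast
qed

lemma compactin_lambda_UN_subset_clopen_ext:
  fixes K :: "nat \<Rightarrow> _"
  assumes "\<And>n. compactin \<Lambda> (K n)"
  obtains S where "clopen_Lindelof X S" "(\<Union>n. K n) \<subseteq> clopen_ext X S"
proof -
  have "\<exists>S. clopen_Lindelof X S \<and> K n \<subseteq> clopen_ext X S" for n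
    using compactin_lambda_subset_clopen_ext[OF assms] by metis
  then obtain S where S: "\<And>n. clopen_Lindelof X (S n)" "\<And>n. K n \<subseteq> clopen_ext X (S n)" by metis
  obtain T where "clopen_Lindelof X T" "\<And>U. U \<in> range S \<Longrightarrow> clopen_ext X U \<subseteq> clopen_ext X T"
    by (rule clopen_Lindelof_countable_bound[of "range S"]) (use S(1) in auto)
  then show ?thesis using that[of T] S(2) by blast
qed

text \<open>Without a finite subcover there is for each \<open>n\<close> a point \<open>p n\<close>
  outside the first members of the cover. All these points lie in one compact
  \<open>clopen_ext X S\<close>, which finitely many members cover, a contradiction.\<close>

lemma countably_compact_lambda: "countably_compact_space \<Lambda>"
  unfolding countably_compact_space_def
proof (intro allI impI, elim conjE)
  fix \<U> assume \<U>: "countable \<U>" "\<forall>U\<in>\<U>. openin \<Lambda> U" "\<Union>\<U> = topspace \<Lambda>"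
  show "\<exists>\<V>. finite \<V> \<and> \<V> \<subseteq> \<U> \<and> \<Union>\<V> = topspace \<Lambda>"
  proof (rule ccontr)
    assume neg: "\<not> ?thesis"
    then have ne: "\<U> \<noteq> {}" using \<U>(3) by fastforce
    define U where "U = from_nat_into \<U>"
    have U: "U n \<in> \<U>" for n unfolding U_def using ne by (rule from_nat_into)
    have rU: "range U = \<U>" unfolding U_def using ne \<U>(1) by (rule range_from_nat_into)
    have "\<exists>p. p \<in> topspace \<Lambda> - \<Union>(U ` {..n})" for n
    proof (rule ccontr)
      assume "\<not> ?thesis"
      then have "\<Union>(U ` {..n}) = topspace \<Lambda>" using U \<U>(3) by blast
      moreover have "finite (U ` {..n})" "U ` {..n} \<subseteq> \<U>" using U by auto
      ultimately show False using neg by blast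
    qed
    then obtain p where p: "\<And>n. p n \<in> topspace \<Lambda> - \<Union>(U ` {..n})" by metis
    have "compactin \<Lambda> {p n}" for n using p[of n] by (simp only: compactin_sing) blast
    then obtain S where S: "clopen_Lindelof X S" "(\<Union>n. {p n}) \<subseteq> clopen_ext X S"
      by (rule compactin_lambda_UN_subset_clopen_ext)
    have "clopen_ext X S \<subseteq> \<Union>\<U>"
      using clopen_ext_subset_lambda_set[OF S(1)] \<U>(3) topspace_lambda by simp
    then obtain \<F> where \<F>: "finite \<F>" "\<F> \<subseteq> \<U>" "clopen_ext X S \<subseteq> \<Union>\<F>"
      using compactin_clopen_ext[OF S(1)] \<U>(2) unfolding compactin_def by meson
    then obtain N where N: "finite N" "\<F> = U ` N" using rU by (metis finite_subset_image)
    obtain m where "N \<subseteq> {..m}" using N(1) finite_nat_iff_bounded_le by auto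
    moreover have "p m \<in> \<Union>(U ` N)" using S(2) \<F>(3) N(2) by blast
    ultimately show False using p[of m] by blast
  qed
qed

lemma C_c_lambda_eq_C_0: "(C_c \<Lambda> :: (_ \<Rightarrow> 'k::real_normed_field) set) = C_0 \<Lambda>"
proof
  show "(C_0 \<Lambda> :: (_ \<Rightarrow> 'k) set) \<subseteq> C_c \<Lambda>"
  proof
    fix f :: "_ \<Rightarrow> 'k" assume f: "f \<in> C_0 \<Lambda>"
    have "compactin \<Lambda> {x \<in> topspace \<Lambda>. norm (f x) \<ge> inverse (real (Suc n))}" for n
      using f unfolding C_0_def by (simp del: topspace_subtopology)
    then obtain S where S: "clopen_Lindelof X S"
        "(\<Union>n. {x \<in> topspace \<Lambda>. norm (f x) \<ge> inverse (real (Suc n))}) \<subseteq> clopen_ext X S"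
      by (rule compactin_lambda_UN_subset_clopen_ext)
    then have "Coz \<Lambda> f \<subseteq> clopen_ext X S" by (simp only: Coz_eq_Union_norm_ge)
    then show "f \<in> C_c \<Lambda>"
      using f by (intro C_cI[OF Hausdorff_lambda _ _ compactin_clopen_ext[OF S(1)]]) (simp_all add: C_0_def C_b_def)
  qed
qed (rule C_c_subset_C_0)

end

section \<open>The algebra \<open>C_P lindelof X\<close> and its identification with
  \<open>C_c \<Lambda>\<close>\<close>

locale regular_clopen_partition = clopen_partition +
  assumes Hausdorff: "Hausdorff_space X" and regular: "regular_space X" and nonempty: "topspace X \<noteq> {}"
begin

lemma lindelof_subtopology_iff: "lindelof (subtopology X S) \<longleftrightarrow> Lindelof_space (subtopology X S)"
  by (simp add: lindelof_def Hausdorff_space_subtopology Hausdorff regular_space_subtopology regular)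

lemma lambda_P_eq: "lambda_P TYPE('k::real_normed_field) lindelof X = \<Lambda>"
  unfolding lambda_set_def
  by (rule lambda_lindelof_eq[OF regular Hausdorff]) (rule Lindelof_subset_clopen_Lindelof)

lemma supp_subset_clopen: "clopen_Lindelof X S \<Longrightarrow> supp X f \<subseteq> S \<longleftrightarrow> Coz X f \<subseteq> S"
  unfolding supp_def clopen_Lindelof_def
  by (metis Coz_subset_supp closure_of_minimal order_trans supp_def)

lemma supp_lindelof_iff:
  "lindelof (subtopology X (supp X f)) \<longleftrightarrow> (\<exists>S. clopen_Lindelof X S \<and> Coz X f \<subseteq> S)"
proof
  assume "lindelof (subtopology X (supp X f))"
  then obtain S where S: "clopen_Lindelof X S" "supp X f \<subseteq> S"
    using Lindelof_subset_clopen_Lindelof[of "supp X f"] closure_of_subset_topspace[of X]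
    unfolding lindelof_subtopology_iff supp_def by blast
  then show "\<exists>S. clopen_Lindelof X S \<and> Coz X f \<subseteq> S" using supp_subset_clopen by blast
next
  assume "\<exists>S. clopen_Lindelof X S \<and> Coz X f \<subseteq> S"
  then obtain S where S: "clopen_Lindelof X S" "supp X f \<subseteq> S" using supp_subset_clopen by blast
  then have "closedin (subtopology X S) (supp X f)"
    by (simp add: supp_def closedin_subset_topspace)
  then have "Lindelof_space (subtopology (subtopology X S) (supp X f))"
    using S(1) Lindelof_space_closedin_subtopology by (auto simp: clopen_Lindelof_def)
  then show "lindelof (subtopology X (supp X f))"
    using S(2) by (simp add: lindelof_subtopology_iff subtopology_subtopology Int_absorb1)
qed

text \<open>A Lindelof neighbourhood of the support is contained in a clopen Lindelof
  \<open>S\<close>; conversely \<open>S\<close>, being closed, contains the support and, being open,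
  is a neighbourhood of it.\<close>

lemma C_P_iff:
  "f \<in> C_P lindelof X \<longleftrightarrow> f \<in> C_b X \<and> (\<exists>S. clopen_Lindelof X S \<and> Coz X f \<subseteq> S)"
proof -
  have "has_P_neighbourhood lindelof X (supp X f) \<longleftrightarrow> (\<exists>S. clopen_Lindelof X S \<and> Coz X f \<subseteq> S)"
  proof
    assume "has_P_neighbourhood lindelof X (supp X f)"
    then obtain N where N: "N \<subseteq> topspace X" "supp X f \<subseteq> X interior_of N" "Lindelof_space (subtopology X N)"
      unfolding has_P_neighbourhood_def lindelof_subtopology_iff by blast
    obtain S where S: "clopen_Lindelof X S" "N \<subseteq> S"
      using Lindelof_subset_clopen_Lindelof[OF N(1,3)] by blast
    have "Coz X f \<subseteq> S"
      using Coz_subset_supp[of X f] N(2) interior_of_subset[of X N] S(2) by blast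
    then show "\<exists>S. clopen_Lindelof X S \<and> Coz X f \<subseteq> S" using S(1) by blast
  next
    assume "\<exists>S. clopen_Lindelof X S \<and> Coz X f \<subseteq> S"
    then obtain S where S: "clopen_Lindelof X S" "supp X f \<subseteq> S" using supp_subset_clopen by blast
    then show "has_P_neighbourhood lindelof X (supp X f)"
      unfolding has_P_neighbourhood_def lindelof_subtopology_iff clopen_Lindelof_def
      by (intro exI[of _ S]) (auto simp: interior_of_openin dest: openin_subset)
  qed
  then show ?thesis by (simp add: C_P_def)
qed

lemma C_P_eq_lindelof_supp:
  "C_P lindelof X = {f \<in> C_b X. lindelof (subtopology X (supp X f))}"
  by (auto simp: C_P_iff supp_lindelof_iff)

lemma C_P_common_support:
  assumes "\<And>n::nat. s n \<in> C_P lindelof X"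
  obtains S where "clopen_Lindelof X S" "\<And>n. Coz X (s n) \<subseteq> S"
proof -
  obtain S where S: "\<And>n. clopen_Lindelof X (S n)" "\<And>n. Coz X (s n) \<subseteq> S n"
    using assms unfolding C_P_iff by metis
  obtain T where "clopen_Lindelof X T" "\<And>U. U \<in> range S \<Longrightarrow> U \<subseteq> T"
    by (rule clopen_Lindelof_countable_bound[of "range S"]) (use S(1) in auto)
  then show ?thesis using that[of T] S(2) by blast
qed

lemma subalgebra_C_P: "subalgebra_C_b X (C_P lindelof X :: ('a \<Rightarrow> 'k::real_normed_field) set)"
  unfolding subalgebra_C_b_def
proof (intro conjI ballI allI)
  show "C_P lindelof X \<subseteq> (C_b X :: ('a \<Rightarrow> 'k) set)" by (auto simp: C_P_def)
  have "clopen_Lindelof X {}" using clopen_Lindelof_Union[of "{}"] by simp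
  then show "(\<lambda>x. 0) \<in> (C_P lindelof X :: ('a \<Rightarrow> 'k) set)"
    by (auto simp: C_P_iff C_b_iff Coz_def)
  fix f g :: "'a \<Rightarrow> 'k" and c
  assume f: "f \<in> C_P lindelof X"
  then obtain S where S: "clopen_Lindelof X S" "Coz X f \<subseteq> S" "f \<in> C_b X" unfolding C_P_iff by blast
  have "Coz X (\<lambda>x. c * f x) \<subseteq> S" using S(2) by (auto simp: Coz_def)
  then show "(\<lambda>x. c * f x) \<in> C_P lindelof X"
    using S C_b_closed_under(2)[OF S(3) S(3)] unfolding C_P_iff by blast
  assume g: "g \<in> C_P lindelof X"
  then have gC: "g \<in> C_b X" unfolding C_P_iff by blast
  obtain T where T: "clopen_Lindelof X T" "Coz X f \<subseteq> T" "Coz X g \<subseteq> T"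
  proof -
    obtain T where T: "clopen_Lindelof X T" "\<And>n::nat. Coz X (if n = 0 then f else g) \<subseteq> T"
      by (rule C_P_common_support[of "\<lambda>n. if n = 0 then f else g"]) (use f g in auto)
    show ?thesis using that[OF T(1)] T(2)[of 0] T(2)[of 1] by simp
  qed
  have "Coz X (\<lambda>x. f x + g x) \<subseteq> Coz X f \<union> Coz X g" by (auto simp: Coz_def)
  then have "Coz X (\<lambda>x. f x + g x) \<subseteq> T" using T by blast
  then show "(\<lambda>x. f x + g x) \<in> C_P lindelof X"
    using T(1) C_b_closed_under(1)[OF S(3) gC] unfolding C_P_iff by blast
  have "Coz X (\<lambda>x. f x * g x) \<subseteq> T" using T(2) by (auto simp: Coz_def)
  then show "(\<lambda>x. f x * g x) \<in> C_P lindelof X"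
    using T(1) C_b_closed_under(3)[OF S(3) gC] unfolding C_P_iff by blast
qed

lemma supnorm_complete_C_P:
  "supnorm_complete X (C_P lindelof X :: ('a \<Rightarrow> 'k::{real_normed_field, euclidean_space}) set)"
  unfolding supnorm_complete_def
proof (intro allI impI, elim conjE)
  fix s :: "nat \<Rightarrow> 'a \<Rightarrow> 'k"
  assume s: "\<forall>n. s n \<in> C_P lindelof X"
    and cauchy: "\<forall>e>0. \<exists>N. \<forall>m\<ge>N. \<forall>n\<ge>N. supnorm X (\<lambda>x. s m x - s n x) < e"
  have sC: "\<And>n. s n \<in> C_b X" using s unfolding C_P_iff by blast
  obtain f where f: "f \<in> C_b X" "(\<lambda>n. supnorm X (\<lambda>x. s n x - f x)) \<longlonglongrightarrow> 0" "\<And>x. (\<lambda>n. s n x) \<longlonglongrightarrow> f x"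
    using C_b_complete[OF nonempty sC cauchy[rule_format]] by blast
  have sP: "s n \<in> C_P lindelof X" for n using s by blast
  obtain S where S: "clopen_Lindelof X S" "\<And>n. Coz X (s n) \<subseteq> S"
    using C_P_common_support[of s, OF sP] by metis
  have "f x = 0" if x: "x \<in> topspace X - S" for x
  proof -
    have "s n x = 0" for n using S(2)[of n] x by (auto simp: Coz_def)
    then show ?thesis using f(3)[of x] by (simp add: LIMSEQ_const_iff)
  qed
  then have "Coz X f \<subseteq> S" by (auto simp: Coz_def)
  then have "f \<in> C_P lindelof X" using f(1) S(1) unfolding C_P_iff by blast
  then show "\<exists>f\<in>C_P lindelof X. (\<lambda>n. supnorm X (\<lambda>x. s n x - f x)) \<longlonglongrightarrow> 0" using f(2) by blast
qed

lemma lambda_dense: "\<Lambda> closure_of (beta_embed X ` topspace X) = topspace \<Lambda>"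
proof
  show "topspace \<Lambda> \<subseteq> \<Lambda> closure_of (beta_embed X ` topspace X)"
  proof
    fix p assume p: "p \<in> topspace \<Lambda>"
    then have "p \<in> beta X closure_of (beta_embed X ` topspace X)" by (simp add: beta_dense)
    then show "p \<in> \<Lambda> closure_of (beta_embed X ` topspace X)"
      using p unfolding in_closure_of openin_open_subtopology[OF openin_lambda_set] by blast
  qed
qed (rule closure_of_subset_topspace)

lemma C_P_isomorphic_C_c_lambda:
  "isometrically_isomorphic X (C_P lindelof X :: ('a \<Rightarrow> 'k::{real_normed_field, euclidean_space}) set)
     \<Lambda> (C_c \<Lambda>)"
proof -
  \<comment> \<open>Restriction of functions on \<open>\<Lambda>\<close> to \<open>X\<close>, set to
    0 off \<open>topspace X\<close> as the representation of functions demands. Density of the image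
    makes it isometric and injective.\<close>
  define \<psi> :: "((('a \<Rightarrow> real) \<Rightarrow> real) \<Rightarrow> 'k) \<Rightarrow> ('a \<Rightarrow> 'k)"
    where "\<psi> g = (\<lambda>x. if x \<in> topspace X then g (beta_embed X x) else 0)" for g
  have cemb: "continuous_map X \<Lambda> (beta_embed X)"
    using continuous_map_beta_embed[of X] beta_embed_in_lambda_set
    by (auto simp: continuous_map_in_subtopology)
  have \<psi>C: "\<psi> g \<in> C_P lindelof X" if g: "g \<in> C_c \<Lambda>" for g
  proof -
    note C = C_cD[OF g]
    have "continuous_map X euclidean (g \<circ> beta_embed X)"
      by (rule continuous_map_compose[OF cemb C(1)])
    then have "continuous_map X euclidean (\<psi> g)"
      by (rule continuous_map_eq) (simp add: \<psi>_def)
    moreover have "\<forall>x\<in>topspace X. norm (\<psi> g x) \<le> supnorm \<Lambda> g"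
      using norm_le_supnorm[OF C(4)] beta_embed_in_lambda_set topspace_lambda by (auto simp: \<psi>_def)
    ultimately have "\<psi> g \<in> C_b X" by (auto simp: C_b_iff \<psi>_def)
    moreover obtain S where S: "clopen_Lindelof X S" "supp \<Lambda> g \<subseteq> clopen_ext X S"
      by (rule compactin_lambda_subset_clopen_ext[OF C(3)])
    have "Coz X (\<psi> g) \<subseteq> S"
    proof
      fix x assume x: "x \<in> Coz X (\<psi> g)"
      then have "beta_embed X x \<in> Coz \<Lambda> g"
        using beta_embed_in_lambda_set topspace_lambda by (auto simp: \<psi>_def Coz_def)
      then have "beta_embed X x \<in> clopen_ext X S" using Coz_subset_supp[of \<Lambda> g] S(2) by blast
      then show "x \<in> S"
        using beta_embed_in_clopen_ext[of X S x] S(1) x by (auto simp: clopen_Lindelof_def Coz_def)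
    qed
    ultimately show ?thesis using S(1) unfolding C_P_iff by blast
  qed
  have iso: "supnorm X (\<psi> g) = supnorm \<Lambda> g" if g: "g \<in> C_c \<Lambda>" for g
  proof (rule antisym)
    note C = C_cD[OF g]
    show "supnorm X (\<psi> g) \<le> supnorm \<Lambda> g"
      using norm_le_supnorm[OF C(4)] beta_embed_in_lambda_set topspace_lambda
      by (intro supnorm_le nonempty) (auto simp: \<psi>_def)
    show "supnorm \<Lambda> g \<le> supnorm X (\<psi> g)"
    proof (rule supnorm_le)
      show "topspace \<Lambda> \<noteq> {}" using nonempty beta_embed_in_lambda_set topspace_lambda by blast
      fix p assume "p \<in> topspace \<Lambda>"
      then have p: "p \<in> \<Lambda> closure_of (beta_embed X ` topspace X)" by (simp only: lambda_dense)
      show "norm (g p) \<le> supnorm X (\<psi> g)"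
      proof (rule forall_in_closure_of[OF p])
        fix q assume "q \<in> beta_embed X ` topspace X"
        then obtain x where x: "x \<in> topspace X" "q = beta_embed X x" by blast
        have "\<psi> g \<in> C_b X" using \<psi>C[OF g] unfolding C_P_iff by blast
        from norm_le_supnorm[OF this x(1)] show "norm (g q) \<le> supnorm X (\<psi> g)"
          using x by (simp add: \<psi>_def)
      next
        have "closedin \<Lambda> {p \<in> topspace \<Lambda>. g p \<in> {v. norm v \<le> supnorm X (\<psi> g)}}"
          by (rule closedin_continuous_map_preimage[OF C(1)])
            (simp add: closed_Collect_le continuous_on_norm_id)
        then show "closedin \<Lambda> {p \<in> topspace \<Lambda>. norm (g p) \<le> supnorm X (\<psi> g)}"
          by (simp del: topspace_subtopology)
      qed
    qed
  qed
  have inj: "inj_on \<psi> (C_c \<Lambda>)"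
  proof (rule inj_onI)
    fix g h assume g: "g \<in> C_c \<Lambda>" and h: "h \<in> C_c \<Lambda>" and eq: "\<psi> g = \<psi> h"
    have "g p = h p" for p
    proof (cases "p \<in> topspace \<Lambda>")
      case True
      then have p: "p \<in> \<Lambda> closure_of (beta_embed X ` topspace X)" by (simp only: lambda_dense)
      show ?thesis
      proof (rule forall_in_closure_of_eq[OF p Hausdorff_space_euclidean C_cD(1)[OF g] C_cD(1)[OF h]])
        fix q assume "q \<in> beta_embed X ` topspace X"
        then obtain x where x: "x \<in> topspace X" "q = beta_embed X x" by blast
        then show "g q = h q" using fun_cong[OF eq, of x] by (simp add: \<psi>_def)
      qed
    next
      case False
      then show ?thesis using C_cD(2)[OF g] C_cD(2)[OF h] by simp
    qed
    then show "g = h" by blast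
  qed
  have surj: "f \<in> \<psi> ` C_c \<Lambda>" if f: "f \<in> C_P lindelof X" for f
  proof -
    obtain S where S: "f \<in> C_b X" "clopen_Lindelof X S" "Coz X f \<subseteq> S" using f unfolding C_P_iff by blast
    have Sc: "openin X S" "closedin X S" using S(2) by (auto simp: clopen_Lindelof_def)
    have Sc': "openin X (topspace X - S)" "closedin X (topspace X - S)" using Sc by auto
    obtain F where F: "continuous_map (beta X) euclidean F" "\<And>x. x \<in> topspace X \<Longrightarrow> F (beta_embed X x) = f x"
      using C_b_extends_to_beta[OF S(1)] by metis
    \<comment> \<open>\<open>F\<close> vanishes on the image of \<open>X - S\<close>, hence on its
      closure, which is the complement of \<open>clopen_ext X S\<close>. So the extension is
      supported in a compact subset of \<open>\<Lambda>\<close>.\<close>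
    have F0: "F p = 0" if "p \<in> topspace (beta X)" "p \<notin> clopen_ext X S" for p
    proof -
      have p: "p \<in> beta X closure_of (beta_embed X ` (topspace X - S))"
        using that unfolding beta_closure_of_clopen[OF Sc'] clopen_ext_Compl[OF Sc] by blast
      show ?thesis
      proof (rule forall_in_closure_of_eq[OF p Hausdorff_space_euclidean F(1)])
        show "continuous_map (beta X) euclidean (\<lambda>_. 0 :: 'k)" by simp
        fix q assume "q \<in> beta_embed X ` (topspace X - S)"
        then show "F q = 0" using F(2) S(3) by (auto simp: Coz_def)
      qed
    qed
    define g where "g p = (if p \<in> lambda_set X then F p else 0)" for p
    have "g \<in> C_c \<Lambda>"
    proof (rule C_cI[OF Hausdorff_lambda _ _ compactin_clopen_ext[OF S(2)]])
      show "continuous_map \<Lambda> euclidean g"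
        by (rule continuous_map_eq[OF continuous_map_from_subtopology[OF F(1)]])
          (simp add: g_def)
      show "g p = 0" if "p \<notin> topspace \<Lambda>" for p using that unfolding topspace_lambda by (simp add: g_def)
      show "Coz \<Lambda> g \<subseteq> clopen_ext X S" using F0 by (auto simp: Coz_def g_def)
    qed
    moreover have "\<psi> g = f"
    proof
      fix x show "\<psi> g x = f x"
        using F(2) beta_embed_in_lambda_set S(1) by (simp add: \<psi>_def g_def C_b_iff)
    qed
    ultimately show ?thesis by blast
  qed
  have "\<psi> ` C_c \<Lambda> = C_P lindelof X" using \<psi>C surj by blast
  then have bij: "bij_betw \<psi> (C_c \<Lambda>) (C_P lindelof X)" using inj by (simp add: bij_betw_def)
  show ?thesis
    by (rule isometrically_isomorphicI_inverse[OF bij])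
      (use C_c_closed_under[OF Hausdorff_lambda] iso in \<open>auto simp: \<psi>_def\<close>)
qed

lemma C_0_subset_C_P: "(C_0 X :: ('a \<Rightarrow> 'k::real_normed_field) set) \<subseteq> C_P lindelof X"
proof
  fix f :: "'a \<Rightarrow> 'k" assume f: "f \<in> C_0 X"
  have c: "compactin X {x \<in> topspace X. norm (f x) \<ge> inverse (real (Suc n))}" for n
    using f by (simp add: C_0_def)
  have lin: "Lindelof_space (subtopology X (Coz X f))"
    unfolding Coz_eq_Union_norm_ge
  proof (rule Lindelof_space_Union)
    fix K assume "K \<in> range (\<lambda>n. {x \<in> topspace X. norm (f x) \<ge> inverse (real (Suc n))})"
    then have "compactin X K" using c by blast
    then show "Lindelof_space (subtopology X K)"
      by (simp add: compactin_subspace compact_imp_Lindelof_space)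
  qed simp
  obtain S where "clopen_Lindelof X S" "Coz X f \<subseteq> S"
    using Lindelof_subset_clopen_Lindelof[OF _ lin] by (auto simp: Coz_def)
  then show "f \<in> C_P lindelof X" using f unfolding C_P_iff by (auto simp: C_0_def)
qed

lemma uncountable_pieces:
  assumes "\<not> lindelof X"
  shows "uncountable \<B>"
proof
  assume "countable \<B>"
  then have "clopen_Lindelof X (topspace X)"
    using clopen_Lindelof_Union[of \<B>] Union_pieces by simp
  then show False using assms Hausdorff regular by (simp add: clopen_Lindelof_def lindelof_def)
qed

text \<open>The indicator of a union of countably infinitely many pieces has Lindelof support, but
  its level set at 1 is that union, which the pieces cover without any finite subcover.\<close>

lemma C_0_neq_C_P:
  assumes "\<not> lindelof X"
  shows "(C_0 X :: ('a \<Rightarrow> 'k::real_normed_field) set) \<noteq> C_P lindelof X"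
proof
  assume eq: "(C_0 X :: ('a \<Rightarrow> 'k) set) = C_P lindelof X"
  have "infinite \<B>" using uncountable_pieces[OF assms] countable_finite by blast
  then obtain \<J> where J: "\<J> \<subseteq> \<B>" "infinite \<J>" "countable \<J>"
    using infinite_countable_subset' by blast
  define f :: "'a \<Rightarrow> 'k" where "f = (\<lambda>x. if x \<in> \<Union>\<J> then 1 else 0)"
  have "f \<in> C_b X" unfolding f_def by (rule indicator_clopen_in_C_b) (rule clopen_Union[OF J(1)])+
  moreover have "Coz X f \<subseteq> \<Union>\<J>" by (auto simp: Coz_def f_def)
  ultimately have "f \<in> C_0 X" unfolding eq C_P_iff using clopen_Lindelof_Union[OF J(1,3)] by blast
  then have "compactin X {x \<in> topspace X. norm (f x) \<ge> 1}" by (simp add: C_0_def)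
  moreover have "{x \<in> topspace X. norm (f x) \<ge> 1} = \<Union>\<J>"
    using openin_subset[OF clopen_Union(1)[OF J(1)]] by (auto simp: f_def)
  ultimately have "compactin X (\<Union>\<J>)" by simp
  moreover have "\<forall>U\<in>\<J>. openin X U" using J(1) openin_piece by blast
  ultimately obtain \<F> where F: "finite \<F>" "\<F> \<subseteq> \<J>" "\<Union>\<J> \<subseteq> \<Union>\<F>"
    unfolding compactin_def by (metis order_refl)
  have "\<J> \<subseteq> \<F>"
  proof
    fix B assume B: "B \<in> \<J>"
    then have "B \<noteq> {}" using J(1) nonempty_pieces by blast
    then obtain x where x: "x \<in> B" by blast
    then obtain B' where B': "B' \<in> \<F>" "x \<in> B'" using B F(3) by blast
    then have "B = B'" using piece_unique[of B B' x] x B F(2) J(1) by blast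
    then show "B \<in> \<F>" using B' by simp
  qed
  then show False using J(2) F(1) finite_subset by blast
qed

lemma lambda_not_lindelof_paracompact_normal:
  assumes "\<not> lindelof X"
  shows "\<not> lindelof \<Lambda>" "\<not> paracompact \<Lambda>" "\<not> normal_T2_space \<Lambda>"
proof -
  have n: "\<not> normal_space \<Lambda>" by (rule lambda_not_normal[OF uncountable_pieces[OF assms]])
  then show "\<not> lindelof \<Lambda>" using regular_Lindelof_imp_normal_space by (auto simp: lindelof_def)
  show "\<not> paracompact \<Lambda>" using n paracompact_imp_normal_space by blast
  show "\<not> normal_T2_space \<Lambda>" using n by (simp add: normal_T2_space_def)
qed

text \<open>Compact sets are Lindelof, which gives one direction. For the other, countably many open
  sets with compact supersets cover the support; cutting these supersets down to the closed support
  keeps them compact.\<close>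

lemma supp_sigma_compact_iff:
  assumes "locally_compact X"
  shows "sigma_compact (subtopology X (supp X f)) \<longleftrightarrow> lindelof (subtopology X (supp X f))"
proof
  have sub: "supp X f \<subseteq> topspace X" unfolding supp_def by (rule closure_of_subset_topspace)
  have clo: "closedin X (supp X f)" by (simp add: supp_def)
  {
    assume "sigma_compact (subtopology X (supp X f))"
    then obtain \<K> where \<K>: "countable \<K>" "\<forall>K\<in>\<K>. compactin X K" "\<Union>\<K> = supp X f"
      using sub by (auto simp: sigma_compact_def compactin_subtopology Int_absorb1)
    have "Lindelof_space (subtopology X (\<Union>\<K>))"
      by (rule Lindelof_space_Union[OF \<K>(1)])
        (use \<K>(2) in \<open>simp add: compactin_subspace compact_imp_Lindelof_space\<close>)
    then show "lindelof (subtopology X (supp X f))" by (simp add: \<K>(3) lindelof_subtopology_iff)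
  }
  assume "lindelof (subtopology X (supp X f))"
  then have lin: "Lindelof_space (subtopology X (supp X f))" by (simp add: lindelof_def)
  define \<U> where "\<U> = {U. openin X U \<and> (\<exists>K. compactin X K \<and> U \<subseteq> K)}"
  have U: "\<forall>U\<in>\<U>. openin X U" by (simp add: \<U>_def)
  have "\<exists>U\<in>\<U>. x \<in> U" if "x \<in> supp X f" for x
    using assms that sub unfolding locally_compact_def locally_compact_space_def \<U>_def by blast
  then have cov: "supp X f \<subseteq> \<Union>\<U>" by blast
  obtain \<V> where \<V>: "countable \<V>" "\<V> \<subseteq> \<U>" "supp X f \<subseteq> \<Union>\<V>"
    using lin U cov unfolding Lindelof_space_subtopology_subset[OF sub] by meson
  have "\<exists>K. compactin X K \<and> U \<subseteq> K" if "U \<in> \<V>" for U using \<V>(2) that by (auto simp: \<U>_def)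
  then obtain K where K: "\<And>U. U \<in> \<V> \<Longrightarrow> compactin X (K U)" "\<And>U. U \<in> \<V> \<Longrightarrow> U \<subseteq> K U" by metis
  show "sigma_compact (subtopology X (supp X f))"
    unfolding sigma_compact_def
  proof (intro exI[of _ "(\<lambda>U. supp X f \<inter> K U) ` \<V>"] conjI ballI)
    show "countable ((\<lambda>U. supp X f \<inter> K U) ` \<V>)" using \<V>(1) by simp
    fix C assume "C \<in> (\<lambda>U. supp X f \<inter> K U) ` \<V>"
    then show "compactin (subtopology X (supp X f)) C"
      using K(1) clo by (auto simp: compactin_subtopology intro: closed_Int_compactin)
  next
    show "\<Union>((\<lambda>U. supp X f \<inter> K U) ` \<V>) = topspace (subtopology X (supp X f))"
    proof -
      have "supp X f \<subseteq> (\<Union>U\<in>\<V>. K U)" using \<V>(3) K(2) by blast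
      then show ?thesis using sub by auto
    qed
  qed
qed

end

theorem theorem4p4:
  fixes X :: "'a topology"
    and Y :: "(('a \<Rightarrow> real) \<Rightarrow> real) topology"
  assumes "topspace X \<noteq> {}"
    and "paracompact X"
    and "locally_P lindelof X"
    and Y: "Y = lambda_P TYPE('k::{real_normed_field, euclidean_space}) lindelof X"
  shows "banach_subalgebra_C_b X (C_P lindelof X :: ('a \<Rightarrow> 'k) set)
    \<and> topspace Y \<noteq> {} \<and> locally_compact Y
    \<and> isometrically_isomorphic X (C_P lindelof X :: ('a \<Rightarrow> 'k) set) Y (C_c Y)
    \<and> (\<forall>Z :: 'z topology. topspace Z \<noteq> {} \<and> locally_compact Z
          \<and> isometrically_isomorphic X (C_P lindelof X :: ('a \<Rightarrow> 'k) set) Z (C_c Z)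
          \<longrightarrow> Z homeomorphic_space Y)
    \<and> (C_P lindelof X :: ('a \<Rightarrow> 'k) set) = {f \<in> C_b X. lindelof (subtopology X (supp X f))}
    \<and> (C_0 X :: ('a \<Rightarrow> 'k) set) \<subseteq> C_P lindelof X
    \<and> (\<not> lindelof X \<longrightarrow> (C_0 X :: ('a \<Rightarrow> 'k) set) \<noteq> C_P lindelof X)
    \<and> (C_c Y :: ((('a \<Rightarrow> real) \<Rightarrow> real) \<Rightarrow> 'k) set) = C_0 Y
    \<and> countably_compact_space Y
    \<and> (\<not> lindelof X \<longrightarrow> \<not> lindelof Y \<and> \<not> paracompact Y)
    \<and> (locally_compact X \<longrightarrow>
          (C_P lindelof X :: ('a \<Rightarrow> 'k) set)
            = {f \<in> C_b X. sigma_compact (subtopology X (supp X f))}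
        \<and> (\<not> lindelof X \<longrightarrow> \<not> normal_T2_space Y))"
proof -
  obtain \<B> where \<B>: "\<Union>\<B> = topspace X" "disjoint \<B>" "{} \<notin> \<B>"
    "\<And>B. B \<in> \<B> \<Longrightarrow> openin X B" "\<And>B. B \<in> \<B> \<Longrightarrow> Lindelof_space (subtopology X B)"
    using paracompact_locally_Lindelof_partition[OF assms(2,3)] by metis
  have "Hausdorff_space X" using assms(2) unfolding paracompact_def by (rule conjunct1)
  then interpret regular_clopen_partition X \<B>
    by unfold_locales
      ((rule \<B> assms(1) paracompact_imp_regular_space[OF assms(2)] | assumption)+)
  have eq: "Y = \<Lambda>" unfolding Y by (rule lambda_P_eq)
  show ?thesis
    unfolding eq banach_subalgebra_C_b_def
  proof (intro conjI allI impI)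
    show "topspace \<Lambda> \<noteq> {}" using nonempty beta_embed_in_lambda_set topspace_lambda by blast
    fix Z :: "'z topology"
    assume "topspace Z \<noteq> {} \<and> locally_compact Z
      \<and> isometrically_isomorphic X (C_P lindelof X :: ('a \<Rightarrow> 'k) set) Z (C_c Z)"
    then show "Z homeomorphic_space \<Lambda>"
      using isometrically_isomorphic_C_c_unique[OF subalgebra_C_P locally_compact_lambda _ C_P_isomorphic_C_c_lambda]
      by blast
  next
    assume "locally_compact X"
    then show "(C_P lindelof X :: ('a \<Rightarrow> 'k) set) = {f \<in> C_b X. sigma_compact (subtopology X (supp X f))}"
      by (simp add: supp_sigma_compact_iff C_P_eq_lindelof_supp)
  next
    show "(C_0 X :: ('a \<Rightarrow> 'k) set) \<noteq> C_P lindelof X" if "\<not> lindelof X"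
      by (rule C_0_neq_C_P[OF that])
  qed (fact subalgebra_C_P supnorm_complete_C_P locally_compact_lambda C_P_isomorphic_C_c_lambda
      C_P_eq_lindelof_supp C_0_subset_C_P C_c_lambda_eq_C_0 countably_compact_lambda
      | erule lambda_not_lindelof_paracompact_normal)+
qed

end
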